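(* Let $\varepsilon>0$, let $W(\phi)=\tfrac14(\phi^2-1)^2$, and let $W=W_c-W_e$ with $W_c,W_e:\mathbb{R}\to\mathbb{R}$ continuously differentiable and both convex. Let $\delta t>0$ and let $\phi^n,\phi^{n+1},\psi^{n+1}$ satisfy, in $\Omega$, $$\frac{Q(\phi^{n+1})-Q(\phi^n)}{\delta t}=\nabla\cdot\bigl(M(\phi^n)\,\nabla\psi^{n+1}\bigr),$$ $$\widehat{Q}'(\phi^{n+1},\phi^n)\,\psi^{n+1}=\frac1\varepsilon\bigl(W_c'(\phi^{n+1})-W_e'(\phi^n)\bigr)-\varepsilon\,\Delta\phi^{n+1},$$ with no-flux boundary conditions $\mathbf{n}\cdot\nabla\phi^{n+1}=0$ and $\mathbf{n}\cdot\nabla\psi^{n+1}=0$ on $\partial\Omega$. Then $$E_\varepsilon[\phi^{n+1}]-E_\varepsilon[\phi^n]\le-\delta t\int_\Omega M(\phi^n)\,|\nabla\psi^{n+1}|^2\,dx-\frac\varepsilon2\int_\Omega|\nabla(\phi^{n+1}-\phi^n)|^2\,dx .$$ In particular, $E_\varepsilon[\phi^{n+1}]\le E_\varepsilon[\phi^n]$.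
   Context: $\Omega\subset\mathbb{R}^d$ is a bounded Lipschitz domain with outward unit normal $\mathbf{n}$. The functions $\phi^n,\phi^{n+1}:\overline\Omega\to[-1,1]$ and $\psi^{n+1}:\overline\Omega\to\mathbb{R}$ are assumed regular enough for the equations to hold classically and for integration by parts, e.g. $\phi^n\in C^1(\overline\Omega)$ and $\phi^{n+1},\psi^{n+1}\in C^2(\overline\Omega)$. The mapping $Q:[-1,1]\to[-1,1]$ is smooth, odd, strictly increasing, with $Q(\pm1)=\pm1$ and $Q'(\phi)>0$ for $|\phi|<1$. The mobility is $M(\phi)=(1-\phi^2)^\ell\ge0$ with $\ell\in\mathbb{N}$. The difference quotient is defined pointwise by $$\widehat{Q}'(\phi^{n+1},\phi^n):=\begin{cases}\dfrac{Q(\phi^{n+1})-Q(\phi^n)}{\phi^{n+1}-\phi^n}, & \phi^{n+1}\ne\phi^n,\\[6pt] Q'(\phi^n), & \phi^{n+1}=\phi^n.\end{cases}$$ The energy is $$E_\varepsilon[\phi]=\int_\Omega\Bigl(\frac1\varepsilon W(\phi)+\frac\varepsilon2|\nabla\phi|^2\Bigr)\,dx .$$ *)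

theory Defs
  imports "HOL-Analysis.Analysis"
begin

subsection \<open>Lipschitz domains and their outward unit normal\<close>

text \<open>
  The point \<open>y - (y \<bullet> e) *\<^sub>R e\<close> is the projection of \<open>y\<close> to the hyperplane orthogonal to \<open>e\<close>, so
  in rotated coordinates \<open>y = (y', y\<^sub>d)\<close> with last axis \<open>e\<close> the set equation below reads
  \<open>y\<^sub>d < \<gamma> y'\<close>. Only the values of \<open>\<gamma>\<close> on that hyperplane matter; a Lipschitz function on the
  hyperplane always extends to the whole space (constantly along \<open>e\<close>).
\<close>

definition lipschitz_chart ::
    "'a::euclidean_space set \<Rightarrow> 'a set \<Rightarrow> 'a \<Rightarrow> ('a \<Rightarrow> real) \<Rightarrow> bool" where
  "lipschitz_chart \<Omega> U e \<gamma> \<longleftrightarrow>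
     open U \<and> norm e = 1 \<and> (\<exists>L. L-lipschitz_on UNIV \<gamma>) \<and>
     \<Omega> \<inter> U = {y \<in> U. y \<bullet> e < \<gamma> (y - (y \<bullet> e) *\<^sub>R e)}"

definition lipschitz_domain :: "'a::euclidean_space set \<Rightarrow> bool" where
  "lipschitz_domain \<Omega> \<longleftrightarrow>
     open \<Omega> \<and> connected \<Omega> \<and> \<Omega> \<noteq> {} \<and>
     (\<forall>x\<in>frontier \<Omega>. \<exists>U e \<gamma>. x \<in> U \<and> lipschitz_chart \<Omega> U e \<gamma>)"

text \<open>
  The normal is the normalised gradient \<open>(-\<nabla>\<gamma>, 1) / sqrt (1 + |\<nabla>\<gamma>|\<^sup>2)\<close> of the local defining
  function \<open>y\<^sub>d - \<gamma> y'\<close>. It exists exactly at the boundary points where \<open>\<gamma>\<close>, as a function on the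
  hyperplane, is differentiable, hence at almost every boundary point (Rademacher). The gradient \<open>D\<close> is never zero since \<open>D \<bullet> e = 1\<close>.
\<close>

definition outward_unit_normal :: "'a::euclidean_space set \<Rightarrow> 'a \<Rightarrow> 'a \<Rightarrow> bool" where
  "outward_unit_normal \<Omega> x n \<longleftrightarrow>
     x \<in> frontier \<Omega> \<and>
     (\<exists>U e \<gamma> D. x \<in> U \<and> lipschitz_chart \<Omega> U e \<gamma> \<and>
        GDERIV (\<lambda>y. y \<bullet> e - \<gamma> (y - (y \<bullet> e) *\<^sub>R e)) x :> D \<and> n = sgn D)"


subsection \<open>Differential operators and regularity up to the boundary\<close>

definition gradient :: "('a::euclidean_space \<Rightarrow> real) \<Rightarrow> 'a \<Rightarrow> 'a" where
  "gradient f x = (THE D. GDERIV f x :> D)"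

definition divergence :: "('a::euclidean_space \<Rightarrow> 'a) \<Rightarrow> 'a \<Rightarrow> real" where
  "divergence F x = (\<Sum>b\<in>Basis. frechet_derivative F (at x) b \<bullet> b)"

definition laplacian :: "('a::euclidean_space \<Rightarrow> real) \<Rightarrow> 'a \<Rightarrow> real" where
  "laplacian f x = divergence (gradient f) x"

text \<open>
  \<open>C\<^sup>k\<close> up to the boundary: the function and its derivatives of order up to \<open>k\<close> exist in \<open>\<Omega>\<close> and
  extend continuously to \<open>closure \<Omega>\<close>. In the second-order case \<open>g\<close> is the extended gradient.
\<close>

definition C1_closure ::
    "'a::euclidean_space set \<Rightarrow> ('a \<Rightarrow> 'b::real_normed_vector) \<Rightarrow> bool" where
  "C1_closure \<Omega> f \<longleftrightarrow>
     continuous_on (closure \<Omega>) f \<and>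
     (\<exists>f'. continuous_on (closure \<Omega>) f' \<and>
        (\<forall>x\<in>\<Omega>. (f has_derivative blinfun_apply (f' x)) (at x)))"

definition C2_closure :: "'a::euclidean_space set \<Rightarrow> ('a \<Rightarrow> real) \<Rightarrow> bool" where
  "C2_closure \<Omega> f \<longleftrightarrow>
     continuous_on (closure \<Omega>) f \<and>
     (\<exists>g. C1_closure \<Omega> g \<and> (\<forall>x\<in>\<Omega>. GDERIV f x :> g x))"

text \<open>
  Functions on \<open>closure \<Omega>\<close> carry no information outside it, so the gradient at a boundary point is
  the boundary value of the gradient in \<open>\<Omega>\<close>. The condition is imposed at every boundary point
  that has a normal.
\<close>

definition no_flux :: "'a::euclidean_space set \<Rightarrow> ('a \<Rightarrow> real) \<Rightarrow> bool" where
  "no_flux \<Omega> f \<longleftrightarrow>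
     (\<forall>x\<in>frontier \<Omega>. \<forall>n. outward_unit_normal \<Omega> x n \<longrightarrow>
        n \<bullet> Lim (at x within \<Omega>) (gradient f) = 0)"


subsection \<open>Ingredients of the scheme\<close>

text \<open>Derivatives at the endpoints of \<open>S = {a..b}\<close> are one-sided.\<close>

definition smooth_on_interval :: "real set \<Rightarrow> (real \<Rightarrow> real) \<Rightarrow> bool" where
  "smooth_on_interval S f \<longleftrightarrow>
     (\<exists>D. D 0 = f \<and>
        (\<forall>k::nat. \<forall>s\<in>S. (D k has_real_derivative D (Suc k) s) (at s within S)))"

definition mobility :: "nat \<Rightarrow> real \<Rightarrow> real" where
  "mobility l s = (1 - s\<^sup>2) ^ l"

definition double_well :: "real \<Rightarrow> real" where
  "double_well s = 1/4 * (s\<^sup>2 - 1)\<^sup>2"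

definition diff_quotient :: "(real \<Rightarrow> real) \<Rightarrow> real \<Rightarrow> real \<Rightarrow> real" where
  "diff_quotient Q s t =
     (if s \<noteq> t then (Q s - Q t) / (s - t)
      else vector_derivative Q (at t within {-1..1}))"

definition energy :: "'a::euclidean_space set \<Rightarrow> real \<Rightarrow> ('a \<Rightarrow> real) \<Rightarrow> real" where
  "energy \<Omega> \<epsilon> \<phi> =
     (LINT x:\<Omega>|lborel. 1 / \<epsilon> * double_well (\<phi> x) + \<epsilon> / 2 * (norm (gradient \<phi> x))\<^sup>2)"

end

theory Submission
  imports Defs
begin

text \<open>
  Multiplying the second equation by \<open>\<phi>\<^sub>1 - \<phi>\<^sub>0\<close> and the first by \<open>\<psi>\<close>, and using the tangent inequalities for
  \<open>W\<^sub>c\<close> at \<open>\<phi>\<^sub>1\<close> and for \<open>W\<^sub>e\<close> at \<open>\<phi>\<^sub>0\<close>, bounds the energy density difference pointwise by the dissipation plus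
  the divergences of \<open>\<psi> M \<nabla>\<psi>\<close> and \<open>(\<phi>\<^sub>1 - \<phi>\<^sub>0) \<nabla>\<phi>\<^sub>1\<close>. Both fields are tangential at the boundary, so all that
  is needed is that the divergence of a tangential \<open>C\<^sup>1\<close> field integrates to zero over a Lipschitz domain.
  After a partition of unity the field is supported in one chart. There it is cut off at distance about \<open>1 / n\<close>
  from the graph, which makes it compactly supported in \<open>\<Omega>\<close>; the error term lives on a layer of measure
  \<open>O (1 / n)\<close>, where the gradient of the cutoff is of size \<open>n\<close> but, almost everywhere, parallel to the normal at
  the boundary point above, so that its product with the field is \<open>o (n)\<close>. The normals exist almost everywhere by
  Rademacher's theorem: in one dimension by Vitali covering, in general by Fubini's theorem and additivity of
  the directional derivatives.
\<close>


subsection \<open>Differentiability of Lipschitz functions on lines\<close>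

text \<open>The obstacle is that normals exist only almost everywhere, and on the boundary this
  would naturally refer to surface measure, which is never introduced. Instead, depth is measured
  along the axis \<open>e\<close> of a chart: the defining function
  \<open>g y - y \<bullet> e\<close> has \<open>g\<close> constant along \<open>e\<close>, so its
  gradient at an interior point is also its gradient at the boundary point on the same line parallel
  to \<open>e\<close>. A Lebesgue null set in the volume is then all that has to be discarded, and
  Rademacher's theorem applies directly in the whole space. The algebra of the scheme is exact up to
  convexity. The difference quotient times the increment of the phase field is the increment of
  \<open>Q\<close>, so the two tested equations cancel without remainder, and evaluating the
  gradient term at the new time gives
  \<open>a \<bullet> (a - b) = (|a|^2 - |b|^2 + |a - b|^2) / 2\<close>, the origin of the additional
  square with factor \<open>\<epsilon> / 2\<close>.\<close>

definition slope_below :: "('a::real_normed_vector \<Rightarrow> real) \<Rightarrow> 'a \<Rightarrow> real \<Rightarrow> 'a set" where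
  "slope_below f v p = {y. \<forall>d>0. \<exists>h. h \<noteq> 0 \<and> \<bar>h\<bar> < d \<and> (f (y + h *\<^sub>R v) - f y) / h < p}"

text \<open>The slopes are two-sided. Vitali covering selects disjoint intervals between
  \<open>x\<close> and \<open>x + h\<close> on which the slope is below \<open>p\<close>; by
  monotonicity the image of each lies in an interval shorter than \<open>p\<close> times its length.
  What the selection misses is null and stays null under a Lipschitz map.\<close>

lemma measure_image_slope_below_le:
  fixes f :: "real \<Rightarrow> real"
  assumes mono: "mono f" and lip: "L-lipschitz_on UNIV f" and "p > 0"
    and S: "S \<in> lmeasurable" "S \<subseteq> slope_below f 1 p" and fS: "f ` S \<in> lmeasurable"
  shows "measure lebesgue (f ` S) \<le> p * measure lebesgue S"
proof (rule field_le_epsilon)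
  fix e' :: real assume "e' > 0"
  \<comment> \<open>The excess measure \<open>e\<close> of the open superset costs
    \<open>p * e = e'\<close> at the end.\<close>
  define e where "e = e' / p"
  have "e > 0" using \<open>e' > 0\<close> \<open>p > 0\<close> by (simp add: e_def)
  obtain T where T: "open T" "S \<subseteq> T" "T - S \<in> lmeasurable" "emeasure lebesgue (T - S) < ennreal e"
    using sets_lebesgue_outer_open S(1) \<open>e > 0\<close> by (metis fmeasurableD)
  have Tm: "T \<in> lmeasurable"
    using fmeasurable.Un[OF S(1) T(3)] T(2) by (simp add: Un_absorb1)
  have mT: "measure lebesgue T \<le> measure lebesgue S + e"
  proof -
    have "measure lebesgue T = measure lebesgue S + measure lebesgue (T - S)"
      using T S(1) Tm by (simp add: measurable_measure_Diff fmeasurableD)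
    moreover have "measure lebesgue (T - S) \<le> e"
      using T(3,4) \<open>e > 0\<close> by (metis emeasure_eq_measure2 ennreal_le_iff less_imp_le)
    ultimately show ?thesis by simp
  qed
  \<comment> \<open>An index is a pair of centre and radius, so \<open>2 * snd i\<close> is the
    length of the interval.\<close>
  define K where "K = {i. 0 < snd i \<and> cball (fst i) (snd i) \<subseteq> T \<and>
    f (fst i + snd i) - f (fst i - snd i) < p * (2 * snd i)}"
  have cov: "\<exists>i. i \<in> K \<and> x \<in> cball (fst i) (snd i) \<and> snd i < d" if "x \<in> S" "0 < d" for x d
  proof -
    obtain \<rho> where \<rho>: "\<rho> > 0" "cball x \<rho> \<subseteq> T"
      using T(1,2) \<open>x \<in> S\<close> open_contains_cball by blast
    obtain h where h: "h \<noteq> 0" "\<bar>h\<bar> < min \<rho> d" "(f (x + h *\<^sub>R 1) - f x) / h < p"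
    proof -
      have "x \<in> slope_below f 1 p" "min \<rho> d > 0" using S(2) \<open>x \<in> S\<close> \<rho>(1) \<open>0 < d\<close> by auto
      then show thesis using that unfolding slope_below_def by blast
    qed
    \<comment> \<open>The interval between \<open>x\<close> and \<open>x + h\<close> written as a
      ball; the sign of \<open>h\<close> decides which endpoint \<open>x\<close> is.\<close>
    have "f (x + h/2 + \<bar>h\<bar>/2) - f (x + h/2 - \<bar>h\<bar>/2) < p * \<bar>h\<bar>"
    proof (cases "h > 0")
      case True
      then have "x + h/2 + \<bar>h\<bar>/2 = x + h" "x + h/2 - \<bar>h\<bar>/2 = x" by (auto simp: field_simps)
      with h(3) True show ?thesis by (simp only: pos_divide_less_eq) (simp add: algebra_simps)
    next
      case False
      then have "x + h/2 + \<bar>h\<bar>/2 = x" "x + h/2 - \<bar>h\<bar>/2 = x + h" by (auto simp: field_simps)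
      with h(1,3) False show ?thesis
        by (simp only: neg_divide_less_eq not_less order.order_iff_strict) (simp add: algebra_simps)
    qed
    moreover have "cball (x + h/2) (\<bar>h\<bar>/2) \<subseteq> T"
    proof -
      have "cball (x + h/2) (\<bar>h\<bar>/2) \<subseteq> cball x \<rho>"
        using h(2) unfolding subset_iff mem_cball dist_real_def by (intro allI impI) linarith
      then show ?thesis using \<rho>(2) by blast
    qed
    ultimately have "(x + h/2, \<bar>h\<bar>/2) \<in> K"
      using h(1) by (simp add: K_def)
    moreover have "x \<in> cball (x + h/2) (\<bar>h\<bar>/2)" by (simp add: dist_real_def)
    moreover have "\<bar>h\<bar>/2 < d" using h(2) by linarith
    ultimately show ?thesis by (metis fst_conv snd_conv)
  qed
  obtain C where C: "countable C" "C \<subseteq> K"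
     "pairwise (\<lambda>i j. disjnt (cball (fst i) (snd i)) (cball (fst j) (snd j))) C"
     "negligible (S - (\<Union>i \<in> C. cball (fst i) (snd i)))"
  proof (rule Vitali_covering_theorem_cballs[of K snd S fst])
    show "0 < snd i" if "i \<in> K" for i using that by (auto simp: K_def)
  qed (use cov that in blast)+
  define N where "N = f ` (S - (\<Union>i \<in> C. cball (fst i) (snd i)))"
  define J where "J i = cbox (f (fst i - snd i)) (f (fst i + snd i))" for i
  have "negligible N"
    unfolding N_def
  proof (rule negligible_locally_Lipschitz_image[OF _ C(4)])
    show "\<exists>T B. open T \<and> x \<in> T \<and> (\<forall>y\<in>(S - (\<Union>i\<in>C. cball (fst i) (snd i))) \<inter> T. norm (f y - f x) \<le> B * norm (y - x))" for x
      by (rule exI[of _ UNIV], rule exI[of _ L])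
         (use lip in \<open>auto simp: lipschitz_on_def dist_norm\<close>)
  qed simp
  \<comment> \<open>Finite subfamilies first: their disjoint intervals lie in \<open>T\<close>, and
    a bound uniform in the subfamily passes to the countable union.\<close>
  have J_bound: "measure lebesgue (\<Union>i\<in>I. J i) \<le> p * measure lebesgue T" if I: "I \<subseteq> C" "finite I" for I
  proof -
    have "measure lebesgue (\<Union>i\<in>I. J i) \<le> (\<Sum>i\<in>I. measure lebesgue (J i))"
      by (rule measure_UNION_le[OF I(2)]) (simp add: J_def)
    also have "\<dots> \<le> (\<Sum>i\<in>I. p * measure lebesgue (cball (fst i) (snd i)))"
    proof (rule sum_mono)
      fix i assume "i \<in> I"
      then have i: "0 < snd i" "f (fst i + snd i) - f (fst i - snd i) < p * (2 * snd i)"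
        using I(1) C(2) by (auto simp: K_def)
      have "f (fst i - snd i) \<le> f (fst i + snd i)"
        using mono i(1) by (simp add: monoD)
      then have "measure lebesgue (J i) = f (fst i + snd i) - f (fst i - snd i)"
        by (simp add: J_def)
      moreover have "measure lebesgue (cball (fst i) (snd i)) = 2 * snd i"
        using i(1) by (simp add: cball_eq_atLeastAtMost)
      ultimately show "measure lebesgue (J i) \<le> p * measure lebesgue (cball (fst i) (snd i))"
        using i by simp
    qed
    also have "\<dots> = p * measure lebesgue (\<Union>i\<in>I. cball (fst i) (snd i))"
    proof -
      have "measure lebesgue (\<Union>i\<in>I. cball (fst i) (snd i)) = (\<Sum>i\<in>I. measure lebesgue (cball (fst i) (snd i)))"
        using I C(3) by (intro measure_UNION') (auto intro: pairwise_subset)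
      then show ?thesis by (simp add: sum_distrib_left)
    qed
    also have "\<dots> \<le> p * measure lebesgue T"
    proof (intro mult_left_mono measure_mono_fmeasurable)
      show "(\<Union>i\<in>I. cball (fst i) (snd i)) \<subseteq> T" using I(1) C(2) unfolding K_def by blast
      show "(\<Union>i\<in>I. cball (fst i) (snd i)) \<in> sets lebesgue" using I(2) by (intro sets.finite_UN) auto
    qed (use Tm \<open>p > 0\<close> in auto)
    finally show ?thesis .
  qed
  have UJ: "(\<Union>i\<in>C. J i) \<in> lmeasurable" "measure lebesgue (\<Union>i\<in>C. J i) \<le> p * measure lebesgue T"
    using fmeasurable_UN_bound[OF C(1) _ J_bound] measure_UN_bound[OF C(1) _ J_bound] by (auto simp: J_def)
  have "f ` S \<subseteq> N \<union> (\<Union>i\<in>C. J i)"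
  proof
    fix z assume "z \<in> f ` S"
    then obtain x where x: "x \<in> S" "z = f x" by blast
    show "z \<in> N \<union> (\<Union>i\<in>C. J i)"
    proof (cases "x \<in> (\<Union>i \<in> C. cball (fst i) (snd i))")
      case True
      then obtain i where "i \<in> C" "x \<in> cball (fst i) (snd i)" by blast
      then have "z \<in> J i"
        using mono x(2) by (auto simp: J_def cball_eq_atLeastAtMost monoD)
      then show ?thesis using \<open>i \<in> C\<close> by blast
    qed (use x in \<open>auto simp: N_def\<close>)
  qed
  then have "measure lebesgue (f ` S) \<le> measure lebesgue (N \<union> (\<Union>i\<in>C. J i))"
    using \<open>negligible N\<close> UJ fS by (intro measure_mono_fmeasurable)
      (auto intro: fmeasurable.Un negligible_imp_measurable)
  also have "\<dots> \<le> measure lebesgue N + measure lebesgue (\<Union>i\<in>C. J i)"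
    using \<open>negligible N\<close> UJ by (intro measure_Un_le) (auto dest: negligible_imp_measurable)
  also have "\<dots> \<le> p * measure lebesgue S + e'"
  proof -
    have "p * measure lebesgue T \<le> p * measure lebesgue S + p * e"
      using mT \<open>p > 0\<close> by (metis distrib_left mult_le_cancel_left_pos)
    then show ?thesis using UJ(2) \<open>negligible N\<close> \<open>p > 0\<close> by (simp add: negligible_imp_measure0 e_def)
  qed
  finally show "measure lebesgue (f ` S) \<le> p * measure lebesgue S + e'" .
qed

text \<open>For a fixed \<open>h\<close> the strict inequality is open in \<open>y\<close>. The
  union over uncountably many \<open>h\<close> is therefore still open, and the set is a countable
  intersection of open sets.\<close>

lemma slope_below_measurable [measurable]:
  fixes f :: "'a::euclidean_space \<Rightarrow> real"
  assumes "continuous_on UNIV f"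
  shows "slope_below f v p \<in> sets borel"
proof -
  define A where "A n = (\<Union>h\<in>{h. h \<noteq> 0 \<and> \<bar>h\<bar> < inverse (real (Suc n))}. {y. (f (y + h *\<^sub>R v) - f y) / h < p})" for n
  have "open (A n)" for n
    unfolding A_def
    by (intro open_UN ballI open_Collect_less continuous_intros continuous_on_compose2[OF assms] assms) auto
  moreover have "slope_below f v p = (\<Inter>n. A n)"
  proof (intro equalityI subsetI)
    fix y assume "y \<in> slope_below f v p"
    then show "y \<in> (\<Inter>n. A n)"
      unfolding slope_below_def A_def by force
  next
    fix y assume y: "y \<in> (\<Inter>n. A n)"
    show "y \<in> slope_below f v p"
      unfolding slope_below_def
    proof (intro CollectI allI impI)
      fix d :: real assume "d > 0"
      then obtain n where "inverse (real (Suc n)) < d" using reals_Archimedean by blast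
      moreover have "y \<in> A n" using y by blast
      ultimately show "\<exists>h. h \<noteq> 0 \<and> \<bar>h\<bar> < d \<and> (f (y + h *\<^sub>R v) - f y) / h < p"
        unfolding A_def by force
    qed
  qed
  ultimately show ?thesis by simp
qed


text \<open>
  On a set \<open>S\<close> of points with lower slope below \<open>p\<close> and upper slope above \<open>q\<close>, the Vitali estimate for \<open>f\<close> gives
  \<open>|f(S)| \<le> p |S|\<close>, and the same estimate for the inverse of \<open>f\<close> gives \<open>|S| \<le> |f(S)| / q\<close>.
\<close>

lemma slope_below_null_expanding:
  fixes f :: "real \<Rightarrow> real"
  assumes lip: "L-lipschitz_on UNIV f" and ex: "\<And>x y. x \<le> y \<Longrightarrow> y - x \<le> f y - f x"
    and pq: "0 < p" "p < q"
  shows "negligible (slope_below f 1 p \<inter> slope_below (\<lambda>x. - f x) 1 (- q))"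
proof -
  have cf: "continuous_on UNIV f" using lip by (rule lipschitz_on_continuous_on)
  have "inj f"
  proof (rule injI)
    fix x y assume "f x = f y"
    then show "x = y" using ex[of x y] ex[of y x] by linarith
  qed
  have "surj f"
    unfolding surj_def
  proof
    fix y
    \<comment> \<open>Because \<open>f\<close> expands distances, these two arguments have values on
      either side of \<open>y\<close>.\<close>
    define a where "a = - \<bar>y - f 0\<bar>"
    define b where "b = \<bar>y - f 0\<bar>"
    have "f a \<le> y" "y \<le> f b" "a \<le> b"
      using ex[of a 0] ex[of 0 b] by (auto simp: a_def b_def)
    then show "\<exists>x. y = f x"
      using IVT'[of f a y b] continuous_on_subset[OF cf] by blast
  qed
  define g where "g = inv f"
  have gf: "g (f x) = x" for x using \<open>inj f\<close> by (simp add: g_def)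
  have fg: "f (g y) = y" for y using \<open>surj f\<close> by (simp add: g_def surj_f_inv_f)
  have mono_f: "mono f" using ex by (intro monoI) (smt (verit))
  have mono_g: "mono g"
  proof (rule monoI, rule ccontr)
    fix x y assume "x \<le> y" "\<not> g x \<le> g y"
    then show False using ex[of "g y" "g x"] fg by auto
  qed
  have lip_g: "1-lipschitz_on UNIV g"
  proof (rule lipschitz_onI)
    fix x y
    show "dist (g x) (g y) \<le> 1 * dist x y"
      using ex[of "g x" "g y"] ex[of "g y" "g x"] fg unfolding dist_real_def by (smt (verit))
  qed simp
  have cg: "continuous_on UNIV g" using lip_g by (rule lipschitz_on_continuous_on)
  define E where "E = slope_below f 1 p \<inter> slope_below (\<lambda>x. - f x) 1 (- q)"
  have E_borel: "E \<in> sets borel"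
    unfolding E_def by (intro sets.Int slope_below_measurable cf continuous_intros)
  \<comment> \<open>Bounded pieces have finite measure \<open>m\<close>, so that
    \<open>q * m \<le> p * m\<close> with \<open>p < q\<close> forces \<open>m = 0\<close>.\<close>
  have "negligible (E \<inter> cball 0 (real n))" for n
  proof -
    define S where "S = E \<inter> cball 0 (real n)"
    have S_borel: "S \<in> sets borel" using E_borel by (auto simp: S_def)
    have S: "S \<in> lmeasurable"
      using S_borel by (intro bounded_set_imp_lmeasurable) (auto simp: S_def)
    \<comment> \<open>As a preimage under the continuous inverse, the image is a Borel set.\<close>
    have "f ` S = g -` S"
      using gf fg by (auto simp: image_iff) (metis fg)
    moreover have "g -` S \<in> sets borel"
      using measurable_sets_borel[OF borel_measurable_continuous_onI[OF cg] S_borel] by simp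
    moreover have "bounded (f ` S)"
      by (rule bounded_subset[OF compact_imp_bounded[OF compact_continuous_image[OF
            continuous_on_subset[OF cf subset_UNIV] compact_cball]]]) (auto simp: S_def)
    ultimately have fS: "f ` S \<in> lmeasurable"
      by (intro bounded_set_imp_lmeasurable) auto
    have gfS: "g ` (f ` S) = S" using gf by (force simp: image_iff)
    have sub: "f ` S \<subseteq> slope_below g 1 (1 / q)"
    proof (rule image_subsetI)
      fix x assume "x \<in> S"
      then have x: "x \<in> slope_below (\<lambda>x. - f x) 1 (- q)" by (simp add: S_def E_def)
      show "f x \<in> slope_below g 1 (1 / q)"
        unfolding slope_below_def
      proof (intro CollectI allI impI)
        fix d :: real assume "d > 0"
        have "isCont f x" using cf by (simp add: continuous_on_eq_continuous_at)
        then obtain r where r: "r > 0" "\<And>x'. \<bar>x' - x\<bar> < r \<Longrightarrow> \<bar>f x' - f x\<bar> < d"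
          using \<open>d > 0\<close> unfolding continuous_at_eps_delta dist_real_def by meson
        obtain h where h: "h \<noteq> 0" "\<bar>h\<bar> < r" "(- f (x + h *\<^sub>R 1) - - f x) / h < - q"
          using x r(1) unfolding slope_below_def by blast
        \<comment> \<open>The increment of \<open>f\<close> becomes the step for its inverse, whose
          slope over \<open>k\<close> is the reciprocal; continuity of \<open>f\<close> keeps
          \<open>k\<close> short.\<close>
        define k where "k = f (x + h) - f x"
        have kh: "k / h > q" using h(3) by (simp add: k_def minus_divide_left[symmetric] diff_divide_distrib)
        have "k \<noteq> 0" using kh pq by auto
        moreover have "\<bar>k\<bar> < d" using r(2)[of "x + h"] h(2) by (simp add: k_def)
        moreover have "(g (f x + k *\<^sub>R 1) - g (f x)) / k < 1 / q"
        proof -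
          have "(g (f x + k *\<^sub>R 1) - g (f x)) / k = inverse (k / h)" by (simp add: k_def gf)
          also have "\<dots> < inverse q" using kh pq by (intro less_imp_inverse_less) auto
          finally show ?thesis by (simp add: inverse_eq_divide)
        qed
        ultimately show "\<exists>h. h \<noteq> 0 \<and> \<bar>h\<bar> < d \<and> (g (f x + h *\<^sub>R 1) - g (f x)) / h < 1 / q" by blast
      qed
    qed
    have "measure lebesgue (f ` S) \<le> p * measure lebesgue S"
      using pq by (intro measure_image_slope_below_le[OF mono_f lip _ S _ fS]) (auto simp: S_def E_def)
    moreover have "measure lebesgue S \<le> 1 / q * measure lebesgue (f ` S)"
      using measure_image_slope_below_le[OF mono_g lip_g _ fS sub] pq gfS S by simp
    ultimately have "q * measure lebesgue S \<le> p * measure lebesgue S"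
      using pq by (simp add: field_simps)
    then have "measure lebesgue S \<le> 0"
      using pq by (simp add: mult_le_cancel_right)
    then show ?thesis using S unfolding S_def
      by (metis measure_le_0_iff negligible_iff_measure)
  qed
  then have "negligible (\<Union>n. E \<inter> cball 0 (real n))"
    by (rule negligible_Union_nat)
  moreover have "(\<Union>n. E \<inter> cball 0 (real n)) = E"
    by (auto simp: real_arch_simple)
  ultimately show ?thesis by (simp add: E_def)
qed

text \<open>All slopes of \<open>f\<close> are at least \<open>- L\<close>. Adding
  \<open>(L + 1) * x\<close> raises them by \<open>L + 1\<close>, which makes the function expanding
  and shifts both thresholds by the same amount.\<close>

lemma slope_below_null_lipschitz:
  fixes f :: "real \<Rightarrow> real"
  assumes lip: "L-lipschitz_on UNIV f" and pq: "p < q"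
  shows "negligible (slope_below f 1 p \<inter> slope_below (\<lambda>x. - f x) 1 (- q))"
proof -
  define F where "F x = f x + (L + 1) * x" for x
  have quot: "(F (x + h *\<^sub>R 1) - F x) / h = (f (x + h *\<^sub>R 1) - f x) / h + (L + 1)" if "h \<noteq> 0" for x h :: real
    using that by (simp add: F_def field_simps)
  have ex: "y - x \<le> F y - F x" if "x \<le> y" for x y
  proof -
    have "\<bar>f x - f y\<bar> \<le> L * \<bar>x - y\<bar>" using lip by (simp add: lipschitz_on_def dist_real_def)
    then show ?thesis using that by (simp add: F_def algebra_simps)
  qed
  have sb: "slope_below f 1 p = slope_below F 1 (p + (L + 1))"
    unfolding slope_below_def using quot by (auto cong: conj_cong)
  have quot': "(- F (x + h *\<^sub>R 1) - - F x) / h = (- f (x + h *\<^sub>R 1) - - f x) / h - (L + 1)" if "h \<noteq> 0" for x h :: real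
    using that by (simp add: F_def field_simps)
  have sa: "slope_below (\<lambda>x. - f x) 1 (- q) = slope_below (\<lambda>x. - F x) 1 (- (q + (L + 1)))"
    unfolding slope_below_def using quot' by (auto cong: conj_cong)
  show ?thesis
  proof (cases "p + (L + 1) > 0")
    case True
    have L: "L \<ge> 0" using lip lipschitz_on_nonneg by blast
    have "(L + norm (L + 1))-lipschitz_on UNIV F"
      unfolding F_def
    proof (intro lipschitz_on_add lip lipschitz_onI)
      show "dist ((L + 1) * x) ((L + 1) * y) \<le> norm (L + 1) * dist x y" for x y
        by (simp add: dist_real_def right_diff_distrib[symmetric] abs_mult)
    qed simp
    from slope_below_null_expanding[OF this ex True, of "q + (L + 1)"] pq show ?thesis
      unfolding sb sa by simp
  next
    \<comment> \<open>The shifted function has no negative slopes, so none lies below a threshold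
      that is not positive.\<close>
    case False
    have slope: "\<not> (F (x + h *\<^sub>R 1) - F x) / h < p + (L + 1)" if "h \<noteq> 0" for x h :: real
    proof (cases "h > 0")
      case True
      then have "(F (x + h) - F x) / h \<ge> 0"
        using ex[of x "x + h"] by (intro divide_nonneg_nonneg) auto
      then show ?thesis using False by simp
    next
      case h: False
      then have "(F (x + h) - F x) / h \<ge> 0"
        using ex[of "x + h" x] by (intro divide_nonpos_nonpos) auto
      then show ?thesis using False by simp
    qed
    have "slope_below F 1 (p + (L + 1)) = {}"
      unfolding slope_below_def using slope zero_less_one by blast
    then show ?thesis unfolding sb by simp
  qed
qed

text \<open>Fubini over pairs of a base point and a shift: for some single \<open>t\<close> the
  property holds at \<open>y + t *\<^sub>R v\<close> for almost every \<open>y\<close>, and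
  translation invariance removes the shift. No rotation of \<open>v\<close> to a coordinate axis is
  involved.\<close>

lemma AE_lborel_line:
  fixes v :: "'a::euclidean_space"
  assumes [measurable]: "Measurable.pred borel P" and line: "\<And>y. AE t in lborel. P (y + t *\<^sub>R v)"
  shows "AE y in lborel. P y"
proof -
  have "AE y in lborel. AE t in (lborel :: real measure). P (y + t *\<^sub>R v)"
    using line by simp
  then have *: "AE t in (lborel :: real measure). AE y in lborel. P (y + t *\<^sub>R v)"
    by (subst (asm) lborel_pair.AE_commute) measurable
  then obtain t :: real where t: "AE y in lborel. P (y + t *\<^sub>R v)"
  proof -
    have "ae_filter (lborel :: real measure) \<noteq> bot" by (simp add: ae_filter_eq_bot_iff)
    with * show thesis using eventually_happens'[of "ae_filter (lborel :: real measure)"] that by blast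
  qed
  have "AE y in distr lborel borel ((+) (t *\<^sub>R v)). P y"
    by (subst AE_distr_iff) (use t in \<open>auto simp: add.commute\<close>)
  then show ?thesis by (simp only: lborel_distr_plus)
qed

lemma AE_not_slope_below:
  fixes f :: "'a::euclidean_space \<Rightarrow> real"
  assumes lip: "L-lipschitz_on UNIV f" and pq: "p < q"
  shows "AE y in lborel. y \<notin> slope_below f v p \<inter> slope_below (\<lambda>x. - f x) v (- q)"
proof (rule AE_lborel_line[where v = v])
  have cf: "continuous_on UNIV f" using lip by (rule lipschitz_on_continuous_on)
  have [measurable]: "slope_below f v p \<in> sets borel" "slope_below (\<lambda>x. - f x) v (- q) \<in> sets borel"
    by (intro slope_below_measurable cf continuous_intros)+
  show "Measurable.pred borel (\<lambda>y. y \<notin> slope_below f v p \<inter> slope_below (\<lambda>x. - f x) v (- q))"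
    by measurable
  fix y
  define \<phi> where "\<phi> t = f (y + t *\<^sub>R v)" for t :: real
  have "(L * norm v)-lipschitz_on UNIV \<phi>"
  proof (rule lipschitz_onI)
    fix s t :: real
    have "dist (f (y + s *\<^sub>R v)) (f (y + t *\<^sub>R v)) \<le> L * dist (y + s *\<^sub>R v) (y + t *\<^sub>R v)"
      using lip by (meson UNIV_I lipschitz_onD)
    also have "dist (y + s *\<^sub>R v) (y + t *\<^sub>R v) = norm v * dist s t"
      by (simp add: dist_norm scaleR_diff_left[symmetric])
    finally show "dist (\<phi> s) (\<phi> t) \<le> L * norm v * dist s t" by (simp add: \<phi>_def)
  qed (simp add: lipschitz_on_nonneg[OF lip])
  from slope_below_null_lipschitz[OF this pq]
  have "AE t in lebesgue. t \<notin> slope_below \<phi> 1 p \<inter> slope_below (\<lambda>x. - \<phi> x) 1 (- q)"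
    by (intro AE_not_in) (simp only: negligible_iff_null_sets)
  moreover have "slope_below \<phi> 1 p = {t. y + t *\<^sub>R v \<in> slope_below f v p}"
    "slope_below (\<lambda>x. - \<phi> x) 1 (- q) = {t. y + t *\<^sub>R v \<in> slope_below (\<lambda>x. - f x) v (- q)}"
    by (simp_all add: slope_below_def \<phi>_def algebra_simps)
  ultimately show "AE t in lborel. y + t *\<^sub>R v \<notin> slope_below f v p \<inter> slope_below (\<lambda>x. - f x) v (- q)"
    by (simp add: AE_completion_iff)
qed

text \<open>Lower and upper slope can differ only if a rational gap \<open>p < q\<close> separates
  them, and there are countably many such gaps to exclude. The Lipschitz bound keeps the common
  value finite.\<close>

lemma lipschitz_AE_directional_derivative:
  fixes f :: "'a::euclidean_space \<Rightarrow> real"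
  assumes lip: "L-lipschitz_on UNIV f"
  shows "AE y in lborel. \<exists>d. ((\<lambda>t. f (y + t *\<^sub>R v)) has_real_derivative d) (at 0)"
proof -
  have "AE y in lborel. \<forall>p\<in>\<rat>. \<forall>q\<in>\<rat>. p < q \<longrightarrow> y \<notin> slope_below f v p \<inter> slope_below (\<lambda>x. - f x) v (- q)"
    using AE_not_slope_below[OF lip] by (auto simp: AE_ball_countable countable_rat)
  then show ?thesis
  proof eventually_elim
    case (elim y)
    define quot where "quot h = (f (y + h *\<^sub>R v) - f y) / h" for h
    have quot_bound: "\<bar>quot h\<bar> \<le> L * norm v" if "h \<noteq> 0" for h
    proof -
      have "\<bar>f (y + h *\<^sub>R v) - f y\<bar> \<le> L * (\<bar>h\<bar> * norm v)"
        using lip unfolding lipschitz_on_def dist_norm by (metis UNIV_I add_diff_cancel_left' norm_scaleR real_norm_def)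
      then show ?thesis using that by (simp add: quot_def field_simps)
    qed
    define A where "A = {p. y \<in> slope_below f v p}"
    have A_iff: "p \<in> A \<longleftrightarrow> (\<forall>d>0. \<exists>h. h \<noteq> 0 \<and> \<bar>h\<bar> < d \<and> quot h < p)" for p
      by (simp add: A_def slope_below_def quot_def)
    have up: "q \<in> A" if "p \<in> A" "p < q" for p q
      using that unfolding A_iff by (meson less_trans)
    have "L * norm v + 1 \<in> A"
      unfolding A_iff
    proof (intro allI impI)
      fix d :: real assume "d > 0"
      then show "\<exists>h. h \<noteq> 0 \<and> \<bar>h\<bar> < d \<and> quot h < L * norm v + 1"
        using quot_bound[of "d/2"] by (intro exI[of _ "d/2"]) auto
    qed
    then have "A \<noteq> {}" by blast
    have lb: "- (L * norm v) \<le> p" if "p \<in> A" for p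
    proof -
      obtain h where "h \<noteq> 0" "quot h < p" using \<open>p \<in> A\<close> unfolding A_iff by (meson zero_less_one)
      then show ?thesis using quot_bound[of h] by auto
    qed
    then have bdd: "bdd_below A" by (rule bdd_belowI)
    \<comment> \<open>The lower derivative at \<open>y\<close> in direction
      \<open>v\<close>.\<close>
    define d where "d = Inf A"
    have "(quot \<longlongrightarrow> d) (at 0)"
    proof (rule tendstoI)
      fix e :: real assume "e > 0"
      have "d - e/2 \<notin> A"
        using cInf_lower[OF _ bdd, of "d - e/2"] \<open>e > 0\<close> by (auto simp: d_def)
      then obtain r1 where r1: "r1 > 0" "\<And>h. h \<noteq> 0 \<Longrightarrow> \<bar>h\<bar> < r1 \<Longrightarrow> quot h \<ge> d - e/2"
        unfolding A_iff by (meson not_less)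
      \<comment> \<open>As \<open>p > d\<close> belongs to \<open>A\<close>, excluding the gap from
        \<open>p\<close> to \<open>q\<close> bounds all slopes over short steps by
        \<open>q < d + e\<close>.\<close>
      obtain p where p: "p \<in> \<rat>" "d < p" "p < d + e/2"
        using Rats_dense_in_real[of d "d + e/2"] \<open>e > 0\<close> by auto
      obtain q where q: "q \<in> \<rat>" "d + e/2 < q" "q < d + e"
        using Rats_dense_in_real[of "d + e/2" "d + e"] \<open>e > 0\<close> by auto
      obtain a where "a \<in> A" "a < p"
        using p(2) cInf_less_iff[OF \<open>A \<noteq> {}\<close> bdd] unfolding d_def by blast
      then have "p \<in> A" using up by blast
      then have "y \<notin> slope_below (\<lambda>x. - f x) v (- q)"
        using elim p q unfolding A_def by fastforce
      then obtain r2 where r2: "r2 > 0" "\<And>h. h \<noteq> 0 \<Longrightarrow> \<bar>h\<bar> < r2 \<Longrightarrow> \<not> (- f (y + h *\<^sub>R v) - - f y) / h < - q"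
        unfolding slope_below_def by blast
      have r2': "quot h \<le> q" if "h \<noteq> 0" "\<bar>h\<bar> < r2" for h
      proof -
        have "(- f (y + h *\<^sub>R v) - - f y) / h = - quot h"
          by (simp add: quot_def minus_divide_left)
        then show ?thesis using r2(2)[OF that] by simp
      qed
      show "\<forall>\<^sub>F h in at 0. dist (quot h) d < e"
        unfolding eventually_at
      proof (intro exI[of _ "min r1 r2"] conjI ballI impI)
        fix h :: real assume "h \<noteq> 0 \<and> dist h 0 < min r1 r2"
        then have "d - e/2 \<le> quot h" "quot h \<le> q" using r1(2) r2' by auto
        then show "dist (quot h) d < e" using q \<open>e > 0\<close> by (auto simp: dist_real_def)
      qed (use r1 r2 in auto)
    qed
    then have "((\<lambda>t. f (y + t *\<^sub>R v)) has_real_derivative d) (at 0)"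
      by (simp add: has_field_derivative_iff quot_def[abs_def])
    then show ?case by blast
  qed
qed


subsection \<open>Rademacher's theorem\<close>

lemma lborel_integral_translate:
  fixes g :: "'a::euclidean_space \<Rightarrow> 'b::{banach, second_countable_topology}"
  assumes [measurable]: "g \<in> borel_measurable borel"
  shows "(\<integral>y. g (y + c) \<partial>lborel) = (\<integral>y. g y \<partial>lborel)"
proof -
  have "(\<integral>y. g y \<partial>lborel) = (\<integral>y. g y \<partial>distr lborel borel ((+) c))"
    by (simp only: lborel_distr_plus)
  also have "\<dots> = (\<integral>y. g (c + y) \<partial>lborel)"
    by (intro integral_distr) auto
  finally show ?thesis by (simp add: add.commute)
qed

text \<open>The function \<open>1 + u / B\<close> is an almost everywhere nonnegative density that
  gives each box its volume, so it reproduces Lebesgue measure, and uniqueness of densities makes it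
  1 almost everywhere.\<close>

lemma AE_eq_0_if_box_integrals_0:
  fixes u :: "'a::euclidean_space \<Rightarrow> real"
  assumes u[measurable]: "u \<in> borel_measurable borel" and bound: "AE x in lborel. \<bar>u x\<bar> \<le> C"
    and int0: "\<And>a b. (\<integral>x. indicator (box a b) x * u x \<partial>lborel) = 0"
  shows "AE x in lborel. u x = 0"
proof -
  define B where "B = max C 1"
  have B: "B > 0" "AE x in lborel. \<bar>u x\<bar> \<le> B" using bound by (auto simp: B_def)
  define \<rho> where "\<rho> x = 1 + u x / B" for x
  have \<rho>_meas[measurable]: "\<rho> \<in> borel_measurable borel" by (simp add: \<rho>_def[abs_def])
  have \<rho>_nonneg: "AE x in lborel. 0 \<le> \<rho> x"
    using B(2) by eventually_elim (use B(1) in \<open>auto simp: \<rho>_def field_simps\<close>)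
  have "lborel = density lborel (\<lambda>x. ennreal (\<rho> x))"
  proof (rule lborel_eqI)
    fix l r :: 'a assume lr: "\<And>b. b \<in> Basis \<Longrightarrow> l \<bullet> b \<le> r \<bullet> b"
    have int1: "integrable lborel (indicator (box l r) :: 'a \<Rightarrow> real)"
      by (simp add: integrable_indicator_iff emeasure_lborel_box_finite[unfolded infinity_ennreal_def])
    have intu: "integrable lborel (\<lambda>x. indicator (box l r) x * u x)"
    proof (rule Bochner_Integration.integrable_bound)
      show "integrable lborel (\<lambda>x. B * indicator (box l r) x)" using int1 by simp
      show "AE x in lborel. norm (indicator (box l r) x * u x) \<le> norm (B * indicator (box l r) x :: real)"
        using B(2) by eventually_elim (use B(1) in \<open>auto simp: indicator_def\<close>)
    qed simp
    have eq: "indicator (box l r) x * \<rho> x = indicator (box l r) x + (indicator (box l r) x * u x) / B" for x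
      by (simp add: \<rho>_def algebra_simps)
    have int\<rho>: "integrable lborel (\<lambda>x. indicator (box l r) x * \<rho> x)"
      unfolding eq using int1 intu by simp
    have "emeasure (density lborel (\<lambda>x. ennreal (\<rho> x))) (box l r)
        = (\<integral>\<^sup>+x. ennreal (\<rho> x) * indicator (box l r) x \<partial>lborel)"
      by (simp add: emeasure_density)
    also have "\<dots> = (\<integral>\<^sup>+x. ennreal (indicator (box l r) x * \<rho> x) \<partial>lborel)"
      by (intro nn_integral_cong) (simp add: indicator_def)
    also have "\<dots> = ennreal (\<integral>x. indicator (box l r) x * \<rho> x \<partial>lborel)"
      using \<rho>_nonneg by (intro nn_integral_eq_integral int\<rho>) (auto elim!: eventually_mono)
    also have "(\<integral>x. indicator (box l r) x * \<rho> x \<partial>lborel) = measure lborel (box l r)"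
      unfolding eq using int1 intu int0 by simp
    also have "ennreal \<dots> = emeasure lborel (box l r)"
      using emeasure_lborel_box_finite[of l r] by (simp add: emeasure_eq_ennreal_measure top.not_eq_extremum)
    finally show "emeasure (density lborel (\<lambda>x. ennreal (\<rho> x))) (box l r) = (\<Prod>b\<in>Basis. (r - l) \<bullet> b)"
      using lr by (simp add: emeasure_lborel_box)
  qed simp
  then have "density lborel (\<lambda>x. ennreal (\<rho> x)) = density lborel (\<lambda>_. 1)"
    by (simp add: density_1)
  then have "AE x in lborel. ennreal (\<rho> x) = 1"
    by (subst (asm) sigma_finite_measure.density_unique_iff[OF sigma_finite_lborel]) auto
  then show ?thesis
    by eventually_elim (use B(1) in \<open>simp add: \<rho>_def\<close>)
qed

text \<open>A limit along one fixed sequence of steps: for continuous \<open>f\<close> it is a limit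
  of continuous functions, hence Borel measurable, and total, with an unspecified value where the
  sequence diverges.\<close>

definition dir_deriv :: "('a::real_normed_vector \<Rightarrow> real) \<Rightarrow> 'a \<Rightarrow> 'a \<Rightarrow> real" where
  "dir_deriv f v y = lim (\<lambda>n. (f (y + (1 / real (Suc n)) *\<^sub>R v) - f y) * real (Suc n))"

lemma dir_deriv_measurable [measurable]:
  fixes f :: "'a::euclidean_space \<Rightarrow> real"
  assumes "continuous_on UNIV f"
  shows "dir_deriv f v \<in> borel_measurable borel"
  unfolding dir_deriv_def
  by (intro borel_measurable_lim_metric borel_measurable_continuous_onI continuous_intros
      continuous_on_compose2[OF assms] assms) auto

lemma difference_quotient_LIMSEQ:
  fixes f :: "'a::real_normed_vector \<Rightarrow> real"
  assumes "((\<lambda>t. f (y + t *\<^sub>R v)) has_real_derivative d) (at 0)"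
  shows "(\<lambda>n. (f (y + (1 / real (Suc n)) *\<^sub>R v) - f y) * real (Suc n)) \<longlonglongrightarrow> d"
proof -
  have lim: "((\<lambda>h. (f (y + h *\<^sub>R v) - f (y + 0 *\<^sub>R v)) / h) \<longlongrightarrow> d) (at 0)"
    using assms unfolding has_field_derivative_iff by (simp only: diff_zero)
  have "filterlim (\<lambda>n. 1 / real (Suc n)) (at 0) sequentially"
    using LIMSEQ_Suc[OF lim_1_over_n] by (auto simp: filterlim_at)
  from filterlim_compose[OF lim this] show ?thesis by simp
qed

lemma dir_deriv_eq:
  assumes "((\<lambda>t. f (y + t *\<^sub>R v)) has_real_derivative d) (at 0)"
  shows "dir_deriv f v y = d"
  unfolding dir_deriv_def using difference_quotient_LIMSEQ[OF assms] by (rule limI)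

lemma lipschitz_dir_deriv:
  fixes f :: "'a::euclidean_space \<Rightarrow> real"
  assumes "L-lipschitz_on UNIV f"
  shows "AE y in lborel. ((\<lambda>t. f (y + t *\<^sub>R v)) has_real_derivative dir_deriv f v y) (at 0)"
  using lipschitz_AE_directional_derivative[OF assms] by eventually_elim (use dir_deriv_eq in blast)

lemma lipschitz_difference_quotient_bound:
  fixes f :: "'a::euclidean_space \<Rightarrow> real"
  assumes "L-lipschitz_on UNIV f"
  shows "\<bar>(f (y + (1 / real (Suc n)) *\<^sub>R v) - f y) * real (Suc n)\<bar> \<le> L * norm v"
proof -
  have "\<bar>f (y + (1 / real (Suc n)) *\<^sub>R v) - f y\<bar> \<le> L * norm ((1 / real (Suc n)) *\<^sub>R v)"
    using lipschitz_onD[OF assms, of "y + (1 / real (Suc n)) *\<^sub>R v" y] by (simp add: dist_norm)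
  also have "\<dots> = L * norm v / real (Suc n)" by simp
  finally show ?thesis by (simp add: abs_mult pos_le_divide_eq del: of_nat_Suc)
qed

lemma dir_deriv_bound:
  fixes f :: "'a::euclidean_space \<Rightarrow> real"
  assumes "L-lipschitz_on UNIV f"
  shows "AE y in lborel. \<bar>dir_deriv f v y\<bar> \<le> L * norm v"
  using lipschitz_dir_deriv[OF assms, of v]
proof eventually_elim
  case (elim y)
  show ?case
    by (rule LIMSEQ_le_const2[OF tendsto_rabs[OF difference_quotient_LIMSEQ[OF elim]]])
       (use lipschitz_difference_quotient_bound[OF assms] in blast)
qed

text \<open>
  Integrated over a box, the difference quotient in direction \<open>v + w\<close> splits into one in direction
  \<open>v\<close> and one in direction \<open>w\<close> over a slightly translated box; the translation disappears in the limit.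
\<close>

lemma dir_deriv_add:
  fixes f :: "'a::euclidean_space \<Rightarrow> real"
  assumes lip: "L-lipschitz_on UNIV f"
  shows "AE y in lborel. dir_deriv f (v + w) y = dir_deriv f v y + dir_deriv f w y"
proof -
  have cf: "continuous_on UNIV f" using lip by (rule lipschitz_on_continuous_on)
  have fm[measurable]: "f \<in> borel_measurable borel" by (rule borel_measurable_continuous_onI[OF cf])
  note [measurable] = dir_deriv_measurable[OF cf]
  have L: "L \<ge> 0" by (rule lipschitz_on_nonneg[OF lip])
  define q where "q v n y = (f (y + (1 / real (Suc n)) *\<^sub>R v) - f y) * real (Suc n)" for v y n
  have qm[measurable]: "q v n \<in> borel_measurable borel" for v n by (simp add: q_def[abs_def])
  have q_lim: "AE y in lborel. (\<lambda>n. q v n y) \<longlonglongrightarrow> dir_deriv f v y" for v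
    using lipschitz_dir_deriv[OF lip, of v]
    by eventually_elim (use difference_quotient_LIMSEQ in \<open>simp add: q_def\<close>)
  have q_bound: "\<bar>q v n y\<bar> \<le> L * norm v" for v n y
    using lipschitz_difference_quotient_bound[OF lip] by (simp add: q_def)
  \<comment> \<open>The defect of additivity, to be tested against all boxes.\<close>
  define u where "u y = dir_deriv f (v + w) y - dir_deriv f v y - dir_deriv f w y" for y
  have "AE y in lborel. u y = 0"
  proof (rule AE_eq_0_if_box_integrals_0)
    show "u \<in> borel_measurable borel" by (simp add: u_def[abs_def])
    show "AE y in lborel. \<bar>u y\<bar> \<le> L * norm (v + w) + L * norm v + L * norm w"
      using dir_deriv_bound[OF lip, of v] dir_deriv_bound[OF lip, of w] dir_deriv_bound[OF lip, of "v + w"]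
      by eventually_elim (simp add: u_def)
    fix a b :: 'a
    let ?I = "indicator (box a b) :: 'a \<Rightarrow> real"
    have intI: "integrable lborel ?I"
      by (simp add: integrable_indicator_iff emeasure_lborel_box_finite[unfolded infinity_ennreal_def])
    have dom: "(\<lambda>n. \<integral>y. ?I y * q v n y \<partial>lborel) \<longlonglongrightarrow> (\<integral>y. ?I y * dir_deriv f v y \<partial>lborel)"
      and intd: "integrable lborel (\<lambda>y. ?I y * dir_deriv f v y)"
      and intq: "\<And>n. integrable lborel (\<lambda>y. ?I y * q v n y)" for v
    proof -
      have w: "integrable lborel (\<lambda>y. ?I y * (L * norm v))" using intI by simp
      have lim: "AE y in lborel. (\<lambda>n. ?I y * q v n y) \<longlonglongrightarrow> ?I y * dir_deriv f v y"
        using q_lim[of v] by eventually_elim (intro tendsto_intros)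
      have bd: "AE y in lborel. norm (?I y * q v n y) \<le> ?I y * (L * norm v)" for n
        using q_bound[of v n] by (auto simp: indicator_def)
      show "(\<lambda>n. \<integral>y. ?I y * q v n y \<partial>lborel) \<longlonglongrightarrow> (\<integral>y. ?I y * dir_deriv f v y \<partial>lborel)"
        by (rule integral_dominated_convergence[OF _ _ w lim bd]) auto
      show "integrable lborel (\<lambda>y. ?I y * dir_deriv f v y)"
        by (rule integrable_dominated_convergence[OF _ _ w lim bd]) auto
      show "integrable lborel (\<lambda>y. ?I y * q v n y)" for n
        by (rule integrable_dominated_convergence2[OF _ _ w lim bd]) auto
    qed
    \<comment> \<open>What is left of the increment starts at the shifted point and goes in
      direction \<open>w\<close>.\<close>
    have split: "q (v + w) n y - q v n y = q w n (y + (1 / real (Suc n)) *\<^sub>R v)" for n y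
      by (simp add: q_def algebra_simps)
    obtain R where R: "box a b \<subseteq> cball 0 R" using bounded_box[of a b] by (auto simp: bounded_iff subset_iff)
    \<comment> \<open>The change of variables moves the shift from the quotient to the box.\<close>
    define J where "J n y = ?I (y - (1 / real (Suc n)) *\<^sub>R v)" for n y
    \<comment> \<open>The indicators of the shifted boxes converge except possibly on the boundary
      of the box, which is null because the box is convex.\<close>
    have "negligible (frontier (box a b))" by (intro negligible_convex_frontier convex_box)
    then have AE_fr: "AE y in lborel. y \<notin> frontier (box a b)"
      using AE_not_in[of "frontier (box a b)" lborel]
      by (metis AE_completion_iff AE_not_in negligible_iff_null_sets)
    have J_lim: "(\<lambda>n. J n y) \<longlonglongrightarrow> ?I y" if "y \<notin> frontier (box a b)" for y
    proof -
      have lim: "(\<lambda>n. y - (1 / real (Suc n)) *\<^sub>R v) \<longlonglongrightarrow> y"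
        using tendsto_diff[OF tendsto_const[of y] tendsto_scaleR[OF LIMSEQ_Suc[OF lim_1_over_n] tendsto_const[of v]]] by simp
      have "y \<in> box a b \<or> y \<in> - closure (box a b)"
        using that unfolding frontier_def interior_open[OF open_box] by blast
      then have "\<forall>\<^sub>F n in sequentially. J n y = ?I y"
      proof
        assume 1: "y \<in> box a b"
        show ?thesis
          using topological_tendstoD[OF lim open_box 1] by eventually_elim (use 1 in \<open>simp add: J_def\<close>)
      next
        assume 2: "y \<in> - closure (box a b)"
        have "y \<notin> box a b" using 2 closure_subset by blast
        moreover have "\<forall>\<^sub>F n in sequentially. y - (1 / real (Suc n)) *\<^sub>R v \<in> - closure (box a b)"
          by (rule topological_tendstoD[OF lim _ 2]) (intro open_Compl closed_closure)
        ultimately show ?thesis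
          by (elim eventually_mono) (use closure_subset[of "box a b"] in \<open>auto simp: J_def indicator_def\<close>)
      qed
      then show ?thesis by (rule tendsto_eventually)
    qed
    have lim1: "(\<lambda>n. \<integral>y. J n y * q w n y \<partial>lborel) \<longlonglongrightarrow> (\<integral>y. ?I y * dir_deriv f w y \<partial>lborel)"
    proof (rule integral_dominated_convergence)
      \<comment> \<open>No shift is longer than \<open>norm v\<close>, so one enlarged ball contains
        all shifted boxes.\<close>
      show "integrable lborel (\<lambda>y::'a. indicator (cball 0 (R + norm v)) y * (L * norm w))"
        using emeasure_bounded_finite[of "cball 0 (R + norm v) :: 'a set"]
        by (intro integrable_mult_left) (simp add: integrable_indicator_iff)
      show "AE y in lborel. (\<lambda>n. J n y * q w n y) \<longlonglongrightarrow> ?I y * dir_deriv f w y"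
        using q_lim[of w] AE_fr by eventually_elim (intro tendsto_mult J_lim)
      show "AE y in lborel. norm (J n y * q w n y) \<le> indicator (cball 0 (R + norm v)) y * (L * norm w)" for n
      proof (intro AE_I2)
        fix y
        show "norm (J n y * q w n y) \<le> indicator (cball 0 (R + norm v)) y * (L * norm w)"
        proof (cases "y - (1 / real (Suc n)) *\<^sub>R v \<in> box a b")
          case True
          then have "norm (y - (1 / real (Suc n)) *\<^sub>R v) \<le> R" using R by auto
          moreover have "norm ((1 / real (Suc n)) *\<^sub>R v) \<le> norm v"
            by (simp add: divide_le_eq mult_left_le_one_le mult_le_cancel_left1)
          ultimately have "norm y \<le> R + norm v"
            using norm_triangle_sub[of y "(1 / real (Suc n)) *\<^sub>R v"] by linarith
          then show ?thesis using q_bound[of w n y] True by (simp add: J_def)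
        next
          case False
          then show ?thesis using L by (simp add: J_def)
        qed
      qed
    qed (auto simp: J_def)
    have "(\<integral>y. ?I y * q (v + w) n y \<partial>lborel) - (\<integral>y. ?I y * q v n y \<partial>lborel) = (\<integral>y. J n y * q w n y \<partial>lborel)" for n
    proof -
      have "(\<integral>y. ?I y * q (v + w) n y \<partial>lborel) - (\<integral>y. ?I y * q v n y \<partial>lborel)
          = (\<integral>y. ?I y * q (v + w) n y - ?I y * q v n y \<partial>lborel)"
        by (rule Bochner_Integration.integral_diff[OF intq intq, symmetric])
      also have "\<dots> = (\<integral>y. J n (y + (1 / real (Suc n)) *\<^sub>R v) * q w n (y + (1 / real (Suc n)) *\<^sub>R v) \<partial>lborel)"
        by (simp only: split[symmetric] right_diff_distrib[symmetric]) (simp add: J_def)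
      also have "\<dots> = (\<integral>y. J n y * q w n y \<partial>lborel)"
        by (rule lborel_integral_translate[where g = "\<lambda>y. J n y * q w n y"]) (simp add: J_def[abs_def])
      finally show ?thesis .
    qed
    with tendsto_diff[OF dom[of "v + w"] dom[of v]]
    have "(\<lambda>n. \<integral>y. J n y * q w n y \<partial>lborel)
        \<longlonglongrightarrow> (\<integral>y. ?I y * dir_deriv f (v + w) y \<partial>lborel) - (\<integral>y. ?I y * dir_deriv f v y \<partial>lborel)"
      by simp
    from LIMSEQ_unique[OF this lim1]
    show "(\<integral>y. ?I y * u y \<partial>lborel) = 0"
      using intd by (simp add: u_def right_diff_distrib)
  qed
  then show ?thesis by eventually_elim (simp add: u_def)
qed

lemma dir_deriv_scaleR:
  fixes f :: "'a::euclidean_space \<Rightarrow> real"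
  assumes lip: "L-lipschitz_on UNIV f"
  shows "AE y in lborel. dir_deriv f (c *\<^sub>R v) y = c * dir_deriv f v y"
  using lipschitz_dir_deriv[OF lip, of v]
proof eventually_elim
  case (elim y)
  have "((\<lambda>t. c * t) has_real_derivative c) (at 0)" by (auto intro!: derivative_eq_intros)
  then have "((\<lambda>t. f (y + (c * t) *\<^sub>R v)) has_real_derivative dir_deriv f v y * c) (at 0)"
    using DERIV_chain'[of "\<lambda>t. c * t" c 0 UNIV "\<lambda>t. f (y + t *\<^sub>R v)"] elim by simp
  then show ?case
    by (intro dir_deriv_eq) (simp add: mult.commute)
qed

lemma dir_deriv_sum:
  fixes f :: "'a::euclidean_space \<Rightarrow> real"
  assumes lip: "L-lipschitz_on UNIV f" and "finite B"
  shows "AE y in lborel. dir_deriv f (\<Sum>b\<in>B. c b *\<^sub>R b) y = (\<Sum>b\<in>B. c b * dir_deriv f b y)"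
  using \<open>finite B\<close>
proof induction
  case empty
  have "dir_deriv f 0 y = 0" for y by (rule dir_deriv_eq) simp
  then show ?case by simp
next
  case (insert b B)
  show ?case
    using insert.IH dir_deriv_add[OF lip, of "c b *\<^sub>R b" "\<Sum>b\<in>B. c b *\<^sub>R b"] dir_deriv_scaleR[OF lip, of "c b" b]
    by eventually_elim (use insert.hyps in simp)
qed

text \<open>A countable dense set of directions has one common null set outside which the
  directional derivatives exist and are given by a single vector. By the Lipschitz bound nearby
  directions behave alike, so a finite net of the unit sphere yields a remainder uniform in the
  direction. The gradient is supplied as a Borel function because it later occurs under an
  integral.\<close>

theorem rademacher:
  fixes f :: "'a::euclidean_space \<Rightarrow> real"
  assumes lip: "L-lipschitz_on UNIV f"
  shows "\<exists>g\<in>borel_measurable borel. AE y in lborel. GDERIV f y :> g y"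
proof -
  have cf: "continuous_on UNIV f" using lip by (rule lipschitz_on_continuous_on)
  obtain D :: "'a set" where D: "countable D" "\<And>X. open X \<Longrightarrow> X \<noteq> {} \<Longrightarrow> \<exists>d\<in>D. d \<in> X"
    by (rule countable_dense_setE) blast
  have L: "L \<ge> 0" by (rule lipschitz_on_nonneg[OF lip])
  define g where "g y = (\<Sum>b\<in>Basis. dir_deriv f b y *\<^sub>R b)" for y
  have "AE y in lborel. ((\<lambda>t. f (y + t *\<^sub>R v)) has_real_derivative v \<bullet> g y) (at 0)" for v
    using lipschitz_dir_deriv[OF lip, of v] dir_deriv_sum[OF lip finite_Basis, of "\<lambda>b. v \<bullet> b"]
  proof eventually_elim
    case (elim y)
    then show ?case
      by (simp add: euclidean_representation g_def inner_sum_right mult.commute)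
  qed
  then have "AE y in lborel. \<forall>v\<in>D. ((\<lambda>t. f (y + t *\<^sub>R v)) has_real_derivative v \<bullet> g y) (at 0)"
    by (simp add: AE_ball_countable D(1))
  then have "AE y in lborel. GDERIV f y :> g y"
  proof eventually_elim
    case (elim y)
    show "GDERIV f y :> g y"
      unfolding gderiv_def has_derivative_within_alt
    proof (intro conjI allI impI)
      show "bounded_linear (\<lambda>h. h \<bullet> g y)" by (rule bounded_linear_inner_left)
      fix e :: real assume "e > 0"
      \<comment> \<open>Three errors must add up to \<open>e\<close> per unit length:
        \<open>L * e'\<close> for moving to the net, \<open>e'\<close> for the derivative there, and
        \<open>e' * norm (g y)\<close> for moving back in the linear part.\<close>
      define e' where "e' = e / (L + 1 + norm (g y))"
      have den: "L + 1 + norm (g y) > 0" using L by (smt (verit) norm_ge_zero)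
      have "e' > 0" using \<open>e > 0\<close> den by (simp add: e'_def)
      have "sphere 0 1 \<subseteq> (\<Union>v\<in>D. ball v e')"
      proof
        fix u :: 'a
        obtain v where "v \<in> D" "v \<in> ball u e'" using D(2)[of "ball u e'"] \<open>e' > 0\<close> by auto
        then show "u \<in> (\<Union>v\<in>D. ball v e')" by (auto simp: dist_commute)
      qed
      then obtain F where F: "F \<subseteq> D" "finite F" "sphere 0 1 \<subseteq> (\<Union>v\<in>F. ball v e')"
        using compactE_image[OF compact_sphere[of "0::'a" 1], of D "\<lambda>v. ball v e'"] by auto
      have "\<forall>\<^sub>F t in at 0. \<forall>v\<in>F. \<bar>(f (y + t *\<^sub>R v) - f y) / t - v \<bullet> g y\<bar> < e'"
      proof (intro eventually_ball_finite[OF F(2)] ballI)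
        fix v assume "v \<in> F"
        then have "((\<lambda>t. (f (y + t *\<^sub>R v) - f y) / t) \<longlongrightarrow> v \<bullet> g y) (at 0)"
          using elim F(1) by (fastforce simp: has_field_derivative_iff)
        from tendstoD[OF this \<open>e' > 0\<close>]
        show "\<forall>\<^sub>F t in at 0. \<bar>(f (y + t *\<^sub>R v) - f y) / t - v \<bullet> g y\<bar> < e'"
          by (simp add: dist_real_def)
      qed
      then obtain r where r: "r > 0"
        "\<And>t v. t \<noteq> 0 \<Longrightarrow> \<bar>t\<bar> < r \<Longrightarrow> v \<in> F \<Longrightarrow> \<bar>(f (y + t *\<^sub>R v) - f y) / t - v \<bullet> g y\<bar> < e'"
        unfolding eventually_at by auto
      show "\<exists>d>0. \<forall>z\<in>UNIV. norm (z - y) < d \<longrightarrow> norm (f z - f y - (z - y) \<bullet> g y) \<le> e * norm (z - y)"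
      proof (intro exI[of _ r] conjI ballI impI)
        fix z assume z: "norm (z - y) < r"
        show "norm (f z - f y - (z - y) \<bullet> g y) \<le> e * norm (z - y)"
        proof (cases "z = y")
          case False
          define t where "t = norm (z - y)"
          define u where "u = (z - y) /\<^sub>R t"
          have t: "t > 0" "t < r" using False z by (auto simp: t_def)
          have "norm u = 1" using t by (simp add: u_def t_def)
          then obtain v where v: "v \<in> F" "norm (u - v) < e'"
            using F(3) by (force simp: dist_norm norm_minus_commute)
          have z_eq: "z = y + t *\<^sub>R u" using t by (simp add: u_def)
          have "f (y + t *\<^sub>R v) - f y - t * (v \<bullet> g y) = t * ((f (y + t *\<^sub>R v) - f y) / t - v \<bullet> g y)"
            using t by (subst right_diff_distrib) simp
          then have "\<bar>f (y + t *\<^sub>R v) - f y - t * (v \<bullet> g y)\<bar> = t * \<bar>(f (y + t *\<^sub>R v) - f y) / t - v \<bullet> g y\<bar>"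
            using t by (simp add: abs_mult)
          also have "\<dots> \<le> t * e'" using r(2)[of t v] t v by (intro mult_left_mono) auto
          finally have 1: "\<bar>f (y + t *\<^sub>R v) - f y - t * (v \<bullet> g y)\<bar> \<le> t * e'" .
          have "\<bar>f (y + t *\<^sub>R u) - f (y + t *\<^sub>R v)\<bar> \<le> L * norm (t *\<^sub>R (u - v))"
            using lipschitz_onD[OF lip, of "y + t *\<^sub>R u" "y + t *\<^sub>R v"] by (simp add: dist_norm scaleR_diff_right)
          also have "\<dots> \<le> L * (t * e')"
            using t v L by (intro mult_left_mono) (auto simp: mult_left_mono less_imp_le)
          finally have 2: "\<bar>f (y + t *\<^sub>R u) - f (y + t *\<^sub>R v)\<bar> \<le> L * (t * e')" .
          have "\<bar>t * ((v - u) \<bullet> g y)\<bar> \<le> t * (norm (v - u) * norm (g y))"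
            using t Cauchy_Schwarz_ineq2[of "v - u" "g y"] by (simp add: abs_mult mult_left_mono)
          also have "\<dots> \<le> t * (e' * norm (g y))"
            using t v by (intro mult_left_mono mult_right_mono) (auto simp: norm_minus_commute)
          finally have 3: "\<bar>t * (v \<bullet> g y) - t * (u \<bullet> g y)\<bar> \<le> t * (e' * norm (g y))"
            by (simp add: inner_diff_left right_diff_distrib)
          have "norm (f z - f y - (z - y) \<bullet> g y) = \<bar>f (y + t *\<^sub>R u) - f y - t * (u \<bullet> g y)\<bar>"
            by (simp add: z_eq)
          also have "\<dots> \<le> L * (t * e') + t * e' + t * (e' * norm (g y))"
            using 1 2 3 by linarith
          also have "\<dots> = (e' * (L + 1 + norm (g y))) * t" by (simp add: algebra_simps)
          also have "\<dots> = e * norm (z - y)" using den by (simp add: e'_def t_def)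
          finally show ?thesis .
        qed simp
      qed (fact r(1))
    qed
  qed
  moreover have "g \<in> borel_measurable borel"
    unfolding g_def[abs_def] using dir_deriv_measurable[OF cf] by measurable
  ultimately show ?thesis by blast
qed


subsection \<open>The divergence theorem for tangential fields\<close>

text \<open>Difference quotients integrate to zero by translation invariance and are dominated
  through the Lipschitz bound and the bounded support. The bound concerns short steps only, since a
  field cut off inside an open set is controlled only near its support.\<close>

lemma integral_directional_derivative_eq_0:
  fixes f :: "'a::euclidean_space \<Rightarrow> real"
  assumes fm[measurable]: "f \<in> borel_measurable borel" and dm[measurable]: "d \<in> borel_measurable borel"
    and intf: "integrable lborel f"
    and supp: "\<And>y. f y \<noteq> 0 \<Longrightarrow> norm y \<le> R"
    and lip: "r > 0" "\<And>y h. norm h < r \<Longrightarrow> \<bar>f (y + h) - f y\<bar> \<le> C * norm h"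
    and deriv: "AE y in lborel. ((\<lambda>t. f (y + t *\<^sub>R v)) has_real_derivative d y) (at 0)"
  shows "integrable lborel d" "(\<integral>y. d y \<partial>lborel) = 0"
proof -
  define q where "q n y = (f (y + (1 / real (Suc n)) *\<^sub>R v) - f y) * real (Suc n)" for n y
  have qm[measurable]: "q n \<in> borel_measurable borel" for n by (simp add: q_def[abs_def])
  have q_lim: "AE y in lborel. (\<lambda>n. q n y) \<longlonglongrightarrow> d y"
    using deriv by eventually_elim (use difference_quotient_LIMSEQ in \<open>simp add: q_def\<close>)
  have q_int: "(\<integral>y. q n y \<partial>lborel) = 0" for n
  proof -
    have intt: "integrable lborel (\<lambda>y. f (y + c))" for c
    proof -
      have "integrable (distr lborel borel ((+) c)) f"
        using intf by (simp only: lborel_distr_plus)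
      then show ?thesis by (subst (asm) integrable_distr_eq) (auto simp: add.commute)
    qed
    have "(\<integral>y. f (y + (1 / real (Suc n)) *\<^sub>R v) - f y \<partial>lborel) = 0"
      using Bochner_Integration.integral_diff[OF intt intf] lborel_integral_translate[OF fm] by simp
    then show ?thesis by (simp add: q_def)
  qed
  have "(\<lambda>n. norm ((1 / real (Suc n)) *\<^sub>R v)) \<longlonglongrightarrow> 0"
    using tendsto_norm[OF tendsto_scaleR[OF LIMSEQ_Suc[OF lim_1_over_n] tendsto_const[of v]]] by simp
  then have "\<forall>\<^sub>F n in sequentially. norm ((1 / real (Suc n)) *\<^sub>R v) < r"
    using lip(1) by (rule order_tendstoD)
  then obtain N where N: "\<And>n. n \<ge> N \<Longrightarrow> norm ((1 / real (Suc n)) *\<^sub>R v) < r"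
    unfolding eventually_sequentially by blast
  \<comment> \<open>Outside this enlarged ball no step of length at most \<open>norm v\<close>
    reaches the support.\<close>
  have w: "integrable lborel (\<lambda>y::'a. indicator (cball 0 (R + norm v)) y * (C * norm v))"
    using emeasure_bounded_finite[of "cball 0 (R + norm v) :: 'a set"]
    by (intro integrable_mult_left) (simp add: integrable_indicator_iff)
  have lim: "AE y in lborel. (\<lambda>n. q (n + N) y) \<longlonglongrightarrow> d y"
    using q_lim by eventually_elim (rule LIMSEQ_ignore_initial_segment)
  have bd: "AE y in lborel. norm (q (n + N) y) \<le> indicator (cball 0 (R + norm v)) y * (C * norm v)" for n
  proof (intro AE_I2)
    fix y
    define k where "k = Suc (n + N)"
    have k: "k > 0" "norm ((1 / real k) *\<^sub>R v) < r" using N[of "n + N"] by (auto simp: k_def)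
    have q: "q (n + N) y = (f (y + (1 / real k) *\<^sub>R v) - f y) * real k" by (simp add: q_def k_def)
    show "norm (q (n + N) y) \<le> indicator (cball 0 (R + norm v)) y * (C * norm v)"
    proof (cases "norm y \<le> R + norm v")
      case True
      have "\<bar>f (y + (1 / real k) *\<^sub>R v) - f y\<bar> \<le> C * norm v / real k"
        using lip(2)[OF k(2), of y] by simp
      then show ?thesis using True k(1) by (simp add: q abs_mult pos_le_divide_eq)
    next
      case False
      have small: "norm ((1 / real k) *\<^sub>R v) \<le> norm v" using k(1) by (simp add: divide_le_eq mult_le_cancel_left1)
      have "f y = 0" using False supp[of y] by (smt (verit) norm_ge_zero)
      moreover have "f (y + (1 / real k) *\<^sub>R v) = 0"
        using False supp[of "y + (1 / real k) *\<^sub>R v"] small norm_triangle_ineq4[of "y + (1 / real k) *\<^sub>R v" "(1 / real k) *\<^sub>R v"]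
        by fastforce
      ultimately show ?thesis using False by (simp add: q)
    qed
  qed
  show "integrable lborel d"
    by (rule integrable_dominated_convergence[OF _ _ w lim bd]) auto
  have "(\<lambda>n. \<integral>y. q (n + N) y \<partial>lborel) \<longlonglongrightarrow> (\<integral>y. d y \<partial>lborel)"
    by (rule integral_dominated_convergence[OF _ _ w lim bd]) auto
  then show "(\<integral>y. d y \<partial>lborel) = 0"
    by (simp add: q_int LIMSEQ_const_iff)
qed

lemma divergence_eq:
  assumes "(F has_derivative D) (at x)"
  shows "divergence F x = (\<Sum>b\<in>Basis. D b \<bullet> b)"
  by (simp add: divergence_def frechet_derivative_at[OF assms, symmetric])

text \<open>The zero extension of \<open>\<zeta> y *\<^sub>R H y\<close> is Lipschitz for short
  steps because \<open>K\<close> keeps a positive distance from the complement of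
  \<open>\<Omega>\<close>. Each component is then differentiated in its own coordinate direction.
  The cutoff may fail to be differentiable on a null set, as a cutoff in the depth below a Lipschitz
  graph does.\<close>

lemma integral_divergence_compact_support:
  fixes H :: "'a::euclidean_space \<Rightarrow> 'a" and \<zeta> :: "'a \<Rightarrow> real"
  assumes \<Omega>: "open \<Omega>"
    and H': "\<And>x. x \<in> \<Omega> \<Longrightarrow> (H has_derivative blinfun_apply (H' x)) (at x)" "continuous_on \<Omega> H'"
    and K: "compact K" "K \<subseteq> \<Omega>"
    and \<zeta>: "M-lipschitz_on UNIV \<zeta>" "\<And>y. \<bar>\<zeta> y\<bar> \<le> X"
    and c: "c \<in> borel_measurable borel" "AE y in lborel. GDERIV \<zeta> y :> c y"
    and supp: "\<And>y. y \<in> \<Omega> - K \<Longrightarrow> \<zeta> y *\<^sub>R H y = 0"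
  shows "(\<integral>y. indicator \<Omega> y *\<^sub>R (\<zeta> y * divergence H y + c y \<bullet> H y) \<partial>lborel) = 0"
proof -
  have cH: "continuous_on \<Omega> H"
    using H'(1) by (meson continuous_at_imp_continuous_on has_derivative_continuous)
  obtain r where r: "r > 0" "(\<Union>y\<in>K. cball y r) \<subseteq> \<Omega>"
    using compact_subset_open_imp_cball_epsilon_subset[OF K(1) \<Omega> K(2)] by blast
  \<comment> \<open>This compact neighbourhood contains every segment of length below
    \<open>r\<close> with an endpoint in \<open>K\<close>; the mean value estimate for
    \<open>H\<close> runs along such segments.\<close>
  define Kr where "Kr = (\<Union>y\<in>K. cball y r)"
  have Kr: "compact Kr" "Kr \<subseteq> \<Omega>"
    using compact_minkowski_sum_cball[OF K(1)] r(2) by (auto simp: Kr_def)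
  obtain B where B: "\<And>y. y \<in> Kr \<Longrightarrow> norm (H y) \<le> B" "B > 0"
    using compact_imp_bounded[OF compact_continuous_image[OF continuous_on_subset[OF cH Kr(2)] Kr(1)]]
    by (auto simp: bounded_pos)
  obtain B' where B': "\<And>y. y \<in> Kr \<Longrightarrow> norm (H' y) \<le> B'" "B' > 0"
    using compact_imp_bounded[OF compact_continuous_image[OF continuous_on_subset[OF H'(2) Kr(2)] Kr(1)]]
    by (auto simp: bounded_pos)
  obtain R where R: "\<And>y. y \<in> K \<Longrightarrow> norm y \<le> R" "R > 0"
    using compact_imp_bounded[OF K(1)] by (auto simp: bounded_pos)
  have X: "X \<ge> 0" using \<zeta>(2)[of 0] by simp
  have M: "M \<ge> 0" by (rule lipschitz_on_nonneg[OF \<zeta>(1)])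
  have c\<zeta>: "continuous_on UNIV \<zeta>" using \<zeta>(1) by (rule lipschitz_on_continuous_on)
  define F where "F y = indicator \<Omega> y *\<^sub>R (\<zeta> y *\<^sub>R H y)" for y
  have F_supp: "F y = 0" if "y \<notin> K" for y
    using that supp[of y] by (auto simp: F_def indicator_def)
  have Fm[measurable]: "F \<in> borel_measurable borel"
    unfolding F_def[abs_def]
    by (intro borel_measurable_continuous_on_indicator continuous_intros cH continuous_on_subset[OF c\<zeta>]) (use \<Omega> in auto)
  have F_bound: "norm (F y) \<le> X * B" for y
  proof (cases "y \<in> K")
    case True
    then have "y \<in> Kr" using r(1) by (force simp: Kr_def)
    then show ?thesis using B(1)[of y] \<zeta>(2)[of y] K(2) True X B(2)
      by (auto simp: F_def intro!: mult_mono)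
  next
    case False
    then show ?thesis using F_supp X B(2) by simp
  qed
  have F_lip: "norm (F (y + h) - F y) \<le> (M * B + X * B') * norm h" if h: "norm h < r" for y h
  proof (cases "y \<in> K \<or> y + h \<in> K")
    case True
    have seg: "closed_segment y (y + h) \<subseteq> Kr"
    proof -
      obtain k where k: "k \<in> K" "{y, y + h} \<subseteq> cball k r"
        using True h r(1) by (auto simp: dist_norm)
      then have "closed_segment y (y + h) \<subseteq> cball k r"
        by (intro closed_segment_subset) auto
      then show ?thesis using k(1) by (auto simp: Kr_def)
    qed
    then have ends: "y \<in> Kr" "y + h \<in> Kr" by auto
    have "norm (H (y + h) - H y) \<le> B' * norm (y + h - y)"
    proof (rule differentiable_bound[of "closed_segment y (y + h)" H "\<lambda>x. blinfun_apply (H' x)"])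
      show "(H has_derivative blinfun_apply (H' x)) (at x within closed_segment y (y + h))"
        if "x \<in> closed_segment y (y + h)" for x
        using H'(1) that seg Kr(2) by (blast intro: has_derivative_at_withinI)
      show "onorm (blinfun_apply (H' x)) \<le> B'" if "x \<in> closed_segment y (y + h)" for x
        using B'(1) that seg by (auto simp: norm_blinfun.rep_eq[symmetric])
    qed auto
    then have dH: "norm (H (y + h) - H y) \<le> B' * norm h" by simp
    have d\<zeta>: "\<bar>\<zeta> (y + h) - \<zeta> y\<bar> \<le> M * norm h"
      using lipschitz_onD[OF \<zeta>(1), of "y + h" y] by (simp add: dist_norm)
    have "F (y + h) - F y = (\<zeta> (y + h) - \<zeta> y) *\<^sub>R H (y + h) + \<zeta> y *\<^sub>R (H (y + h) - H y)"
      using ends Kr(2) by (simp add: F_def subset_iff algebra_simps)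
    also have "norm \<dots> \<le> \<bar>\<zeta> (y + h) - \<zeta> y\<bar> * norm (H (y + h)) + \<bar>\<zeta> y\<bar> * norm (H (y + h) - H y)"
      by (metis norm_scaleR norm_triangle_ineq real_norm_def)
    also have "\<dots> \<le> (M * norm h) * B + X * (B' * norm h)"
      using B(1)[OF ends(2)] d\<zeta> dH \<zeta>(2)[of y] M X by (intro add_mono mult_mono) auto
    finally show ?thesis by (simp add: algebra_simps)
  next
    case False
    then show ?thesis using F_supp M X B(2) B'(2) by simp
  qed
  define D where "D y h = indicator \<Omega> y *\<^sub>R (\<zeta> y *\<^sub>R H' y h + (h \<bullet> c y) *\<^sub>R H y)" for y h
  have F_deriv: "AE y in lborel. (F has_derivative D y) (at y)"
    using c(2)
  proof eventually_elim
    case (elim y)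
    show ?case
    proof (cases "y \<in> \<Omega>")
      case True
      have "((\<lambda>y. \<zeta> y *\<^sub>R H y) has_derivative (\<lambda>h. \<zeta> y *\<^sub>R H' y h + (h \<bullet> c y) *\<^sub>R H y)) (at y)"
        using elim H'(1)[OF True] unfolding gderiv_def by (rule has_derivative_scaleR)
      then have "(F has_derivative (\<lambda>h. \<zeta> y *\<^sub>R H' y h + (h \<bullet> c y) *\<^sub>R H y)) (at y)"
        by (rule has_derivative_transform_within_open[OF _ \<Omega> True]) (simp add: F_def)
      moreover have "D y = (\<lambda>h. \<zeta> y *\<^sub>R H' y h + (h \<bullet> c y) *\<^sub>R H y)"
        using True by (simp add: D_def fun_eq_iff)
      ultimately show ?thesis by simp
    next
      case False
      \<comment> \<open>Off \<open>\<Omega>\<close> the extension vanishes on a whole neighbourhood,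
        the open complement of \<open>K\<close>.\<close>
      have "((\<lambda>_. 0) has_derivative (\<lambda>_. 0 :: 'a)) (at y)" by simp
      moreover have "open (- K)" "y \<in> - K" using False K compact_imp_closed by (auto simp: open_Compl)
      ultimately have "(F has_derivative (\<lambda>_. 0)) (at y)"
        by (rule has_derivative_transform_within_open) (simp add: F_supp)
      moreover have "D y = (\<lambda>_. 0)" using False by (simp add: D_def fun_eq_iff)
      ultimately show ?thesis by simp
    qed
  qed
  have comp: "integrable lborel (\<lambda>y. D y b \<bullet> b) \<and> (\<integral>y. D y b \<bullet> b \<partial>lborel) = 0" if b: "b \<in> Basis" for b
  proof -
    have nb: "norm b = 1" using b by simp
    have [measurable]: "(\<lambda>y. D y b \<bullet> b) \<in> borel_measurable borel"
    proof -
      have [measurable]: "(\<lambda>y. indicator \<Omega> y *\<^sub>R (\<zeta> y *\<^sub>R H' y b)) \<in> borel_measurable borel"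
        "(\<lambda>y. indicator \<Omega> y *\<^sub>R H y) \<in> borel_measurable borel"
        by (intro borel_measurable_continuous_on_indicator continuous_intros cH H'(2) continuous_on_subset[OF c\<zeta>];
            use \<Omega> in simp)+
      have [measurable]: "c \<in> borel_measurable borel" by (rule c(1))
      have eq: "(\<lambda>y. D y b \<bullet> b) = (\<lambda>y. (indicator \<Omega> y *\<^sub>R (\<zeta> y *\<^sub>R H' y b) + (b \<bullet> c y) *\<^sub>R (indicator \<Omega> y *\<^sub>R H y)) \<bullet> b)"
        by (auto simp: D_def indicator_def)
      show ?thesis unfolding eq by measurable
    qed
    have intF: "integrable lborel (\<lambda>y. F y \<bullet> b)"
    proof (rule Bochner_Integration.integrable_bound)
      show "integrable lborel (\<lambda>y::'a. indicator (cball 0 R) y * (X * B))"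
        using emeasure_bounded_finite[of "cball 0 R :: 'a set"]
        by (intro integrable_mult_left) (simp add: integrable_indicator_iff)
      show "AE y in lborel. norm (F y \<bullet> b) \<le> norm (indicator (cball 0 R) y * (X * B))"
      proof (intro AE_I2)
        fix y
        have "\<bar>F y \<bullet> b\<bar> \<le> X * B"
          using Cauchy_Schwarz_ineq2[of "F y" b] F_bound[of y] nb by simp
        then show "norm (F y \<bullet> b) \<le> norm (indicator (cball 0 R) y * (X * B))"
          using F_supp[of y] R(1)[of y] by (cases "y \<in> K") auto
      qed
    qed measurable
    have deriv: "AE y in lborel. ((\<lambda>t. F (y + t *\<^sub>R b) \<bullet> b) has_real_derivative D y b \<bullet> b) (at 0)"
      using F_deriv
    proof eventually_elim
      case (elim y)
      have "((\<lambda>t. y + t *\<^sub>R b) has_derivative (\<lambda>t. t *\<^sub>R b)) (at 0)"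
        by (auto intro!: derivative_eq_intros)
      moreover have "(F has_derivative D y) (at (y + 0 *\<^sub>R b))" using elim by simp
      ultimately have "((\<lambda>t. F (y + t *\<^sub>R b)) has_derivative (\<lambda>t. D y (t *\<^sub>R b))) (at 0)"
        by (rule has_derivative_compose)
      then have "((\<lambda>t. F (y + t *\<^sub>R b) \<bullet> b) has_derivative (\<lambda>t. D y (t *\<^sub>R b) \<bullet> b)) (at 0)"
        by (rule has_derivative_inner_left)
      moreover have "D y (t *\<^sub>R b) \<bullet> b = D y b \<bullet> b * t" for t
        by (simp add: D_def blinfun.scaleR_right algebra_simps)
      ultimately show ?case by (simp add: has_field_derivative_def)
    qed
    have lipb: "\<bar>F (y + h) \<bullet> b - F y \<bullet> b\<bar> \<le> (M * B + X * B') * norm h" if "norm h < r" for y h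
      using Cauchy_Schwarz_ineq2[of "F (y + h) - F y" b] F_lip[OF that, of y] nb by (simp add: inner_diff_left)
    have suppb: "norm y \<le> R" if "F y \<bullet> b \<noteq> 0" for y
      using that F_supp[of y] R(1)[of y] by fastforce
    show ?thesis
      using integral_directional_derivative_eq_0[where f = "\<lambda>y. F y \<bullet> b" and d = "\<lambda>y. D y b \<bullet> b", OF _ _ intF suppb r(1) lipb deriv]
      by simp
  qed
  have eq: "indicator \<Omega> y *\<^sub>R (\<zeta> y * divergence H y + c y \<bullet> H y) = (\<Sum>b\<in>Basis. D y b \<bullet> b)" for y
  proof (cases "y \<in> \<Omega>")
    case True
    have "(\<Sum>b\<in>Basis. (b \<bullet> c y) * (H y \<bullet> b)) = c y \<bullet> H y"
      by (subst euclidean_inner) (simp add: inner_commute)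
    then show ?thesis
      using True by (simp add: D_def divergence_eq[OF H'(1)[OF True]] inner_add_left sum.distrib sum_distrib_left)
  qed (simp add: D_def)
  show ?thesis
    unfolding eq using comp by (simp add: Bochner_Integration.integral_sum)
qed

text \<open>Along the gradient itself the difference quotients tend to \<open>D \<bullet> D\<close>
  while being bounded by \<open>L * norm D\<close>.\<close>

lemma GDERIV_lipschitz_norm_le:
  fixes f :: "'a::euclidean_space \<Rightarrow> real"
  assumes lip: "L-lipschitz_on UNIV f" and D: "GDERIV f y :> D"
  shows "norm D \<le> L"
proof -
  have "((\<lambda>t. y + t *\<^sub>R D) has_derivative (\<lambda>t. t *\<^sub>R D)) (at 0)"
    by (auto intro!: derivative_eq_intros)
  moreover have "(f has_derivative (\<lambda>h. h \<bullet> D)) (at (y + 0 *\<^sub>R D))" using D by (simp add: gderiv_def)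
  ultimately have "((\<lambda>t. f (y + t *\<^sub>R D)) has_derivative (\<lambda>t. (t *\<^sub>R D) \<bullet> D)) (at 0)"
    by (rule has_derivative_compose)
  then have "((\<lambda>t. f (y + t *\<^sub>R D)) has_real_derivative D \<bullet> D) (at 0)"
    by (simp add: has_field_derivative_def mult.commute[of _ "D \<bullet> D"])
  then have "(\<lambda>n. (f (y + (1 / real (Suc n)) *\<^sub>R D) - f y) * real (Suc n)) \<longlonglongrightarrow> D \<bullet> D"
    by (rule difference_quotient_LIMSEQ)
  then have "\<bar>D \<bullet> D\<bar> \<le> L * norm D"
    by (rule LIMSEQ_le_const2[OF tendsto_rabs]) (use lipschitz_difference_quotient_bound[OF lip] in blast)
  then have "norm D * norm D \<le> L * norm D" by (simp add: dot_square_norm power2_eq_square)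
  then show ?thesis
    using lipschitz_on_nonneg[OF lip] by (cases "D = 0") auto
qed

text \<open>The translates of the layer by multiples of \<open>e / n\<close> are disjoint.\<close>

lemma measure_layer_le:
  fixes s :: "'a::euclidean_space \<Rightarrow> real"
  assumes cs: "continuous_on UNIV s" and s: "\<And>y t. s (y + t *\<^sub>R e) = s y - t" and e: "norm e = 1" and n: "n > 0"
  shows "measure lebesgue {y \<in> cball 0 R. 1 / real n < s y \<and> s y < 2 / real n} \<le> measure lebesgue (cball (0::'a) (R + 1)) / n"
proof -
  define A where "A = {y \<in> cball 0 R. 1 / real n < s y \<and> s y < 2 / real n}"
  have [measurable]: "s \<in> borel_measurable borel" by (rule borel_measurable_continuous_onI[OF cs])
  have "A \<in> sets borel" unfolding A_def by measurable
  then have A: "A \<in> lmeasurable"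
    by (intro bounded_set_imp_lmeasurable) (rule bounded_subset[OF bounded_cball[of 0 R]], auto simp: A_def)
  \<comment> \<open>Shifting by \<open>j / n\<close> lowers \<open>s\<close> by
    \<open>j / n\<close>, so on different translates \<open>s\<close> takes values in disjoint
    intervals of length \<open>1 / n\<close>. As \<open>j < n\<close>, no shift exceeds 1, whence
    the radius \<open>R + 1\<close>.\<close>
  define T where "T j = (+) ((real j / real n) *\<^sub>R e) ` A" for j
  have T: "T j \<in> lmeasurable" for j unfolding T_def using A by (rule measurable_translation)
  have s_T: "1 / real n - real j / real n < s y \<and> s y < 2 / real n - real j / real n" if "y \<in> T j" for y j
    using that s by (auto simp: T_def A_def add.commute)
  have "disjnt (T i) (T j)" if "i \<noteq> j" for i j
  proof -
    have False if "y \<in> T i" "y \<in> T j" "i < j" for y i j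
    proof -
      have "1 - real i < 2 - real j"
        using s_T[OF that(1)] s_T[OF that(2)] n
        by (smt (verit, best) diff_divide_distrib divide_right_mono of_nat_0_less_iff)
      then show False using that(3) by simp
    qed
    then show ?thesis using \<open>i \<noteq> j\<close> unfolding disjnt_iff by (metis linorder_neqE_nat)
  qed
  then have "measure lebesgue (\<Union>j\<in>{..<n}. T j) = (\<Sum>j<n. measure lebesgue (T j))"
    by (intro measure_UNION') (auto simp: pairwise_def T)
  also have "\<dots> = n * measure lebesgue A"
    by (simp add: T_def measure_translation)
  finally have "n * measure lebesgue A = measure lebesgue (\<Union>j\<in>{..<n}. T j)" by simp
  also have "\<dots> \<le> measure lebesgue (cball (0::'a) (R + 1))"
  proof (rule measure_mono_fmeasurable)
    show "(\<Union>j\<in>{..<n}. T j) \<subseteq> cball 0 (R + 1)"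
    proof
      fix y assume "y \<in> (\<Union>j\<in>{..<n}. T j)"
      then obtain j x where jx: "j < n" "x \<in> A" "y = (real j / real n) *\<^sub>R e + x" by (auto simp: T_def)
      have "norm y \<le> norm ((real j / real n) *\<^sub>R e) + norm x" unfolding jx by (rule norm_triangle_ineq)
      also have "\<dots> \<le> 1 + R" using jx e by (intro add_mono) (auto simp: A_def)
      finally show "y \<in> cball 0 (R + 1)" by simp
    qed
    show "(\<Union>j\<in>{..<n}. T j) \<in> sets lebesgue" using T by (intro sets.finite_UN) auto
  qed simp
  finally show ?thesis using n unfolding A_def[symmetric] by (simp add: field_simps)
qed

section \<open>A continuously differentiable cutoff profile\<close>

lemma DERIV_max_0_squared: "((\<lambda>t. (max 0 t)\<^sup>2) has_real_derivative 2 * max 0 t) (at (t::real))"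
proof -
  consider "t > 0" | "t < 0" | "t = 0" by linarith
  then show ?thesis
  proof cases
    case 1
    have "((\<lambda>t::real. t\<^sup>2) has_real_derivative 2 * t) (at t)" by (auto intro!: derivative_eq_intros)
    then have "((\<lambda>t. (max 0 t)\<^sup>2) has_real_derivative 2 * t) (at t)"
      by (rule has_field_derivative_transform_within_open[of _ _ _ "{0<..}"]) (use 1 in auto)
    then show ?thesis using 1 by simp
  next
    case 2
    have "((\<lambda>t::real. 0) has_real_derivative 0) (at t)" by simp
    then have "((\<lambda>t. (max 0 t)\<^sup>2) has_real_derivative 0) (at t)"
      by (rule has_field_derivative_transform_within_open[of _ _ _ "{..<0}"]) (use 2 in auto)
    then show ?thesis using 2 by simp
  next
    case 3
    have "((\<lambda>h. ((max 0 (0 + h))\<^sup>2 - (max 0 0)\<^sup>2) / h) \<longlongrightarrow> (0::real)) (at 0)"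
    proof (rule Lim_null_comparison)
      show "\<forall>\<^sub>F h in at 0. norm (((max 0 (0 + h))\<^sup>2 - (max 0 0)\<^sup>2) / h) \<le> \<bar>h::real\<bar>"
        by (rule always_eventually) (auto simp: max_def power2_eq_square)
      show "((\<lambda>h::real. \<bar>h\<bar>) \<longlongrightarrow> 0) (at 0)" by (auto intro!: tendsto_eq_intros)
    qed
    then show ?thesis using 3 by (simp add: DERIV_def)
  qed
qed

text \<open>The primitive of a hat function, used as a \<open>C\<^sup>1\<close> cutoff.\<close>

definition step_fun :: "real \<Rightarrow> real" where
  "step_fun u = 2 * (max 0 u)\<^sup>2 - 4 * (max 0 (u - 1/2))\<^sup>2 + 2 * (max 0 (u - 1))\<^sup>2"

text \<open>The tent over the unit interval with peak 2 at \<open>1/2\<close>. Its unit area lets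
  \<open>step_fun\<close> climb from 0 to 1, and its peak is the Lipschitz constant of
  \<open>step_fun\<close>.\<close>

definition hat_fun :: "real \<Rightarrow> real" where
  "hat_fun u = 4 * max 0 u - 8 * max 0 (u - 1/2) + 4 * max 0 (u - 1)"

lemma DERIV_step_fun: "(step_fun has_real_derivative hat_fun u) (at u)"
proof -
  have shift: "((\<lambda>u. (max 0 (u - a))\<^sup>2) has_real_derivative 2 * max 0 (u - a)) (at u)" for a :: real
    using DERIV_chain'[of "\<lambda>u. u - a" 1 u UNIV "\<lambda>t. (max 0 t)\<^sup>2" "2 * max 0 (u - a)"]
      DERIV_max_0_squared[of "u - a"] by (simp add: DERIV_ident DERIV_diff[OF DERIV_ident DERIV_const, of a, simplified])
  show ?thesis
    unfolding step_fun_def[abs_def] hat_fun_def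
    using DERIV_add[OF DERIV_diff[OF DERIV_cmult[OF shift[of 0], of 2] DERIV_cmult[OF shift[of "1/2"], of 4]]
        DERIV_cmult[OF shift[of 1], of 2]]
    by simp
qed

lemma hat_fun_bounds: "0 \<le> hat_fun u" "hat_fun u \<le> 2"
  by (auto simp: hat_fun_def max_def)

lemma hat_fun_support: "hat_fun u \<noteq> 0 \<Longrightarrow> 0 < u \<and> u < 1"
  by (auto simp: hat_fun_def max_def split: if_splits)

lemma continuous_on_hat_fun: "continuous_on A hat_fun"
  unfolding hat_fun_def[abs_def] by (intro continuous_intros)

lemma step_fun_0: "u \<le> 0 \<Longrightarrow> step_fun u = 0"
  by (simp add: step_fun_def)

lemma step_fun_1: "1 \<le> u \<Longrightarrow> step_fun u = 1"
  by (simp add: step_fun_def power2_eq_square algebra_simps)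

lemma mono_step_fun: "u \<le> v \<Longrightarrow> step_fun u \<le> step_fun v"
  using DERIV_step_fun hat_fun_bounds(1) by (meson DERIV_nonneg_imp_nondecreasing)

lemma step_fun_abs_le: "\<bar>step_fun u\<bar> \<le> 1"
  using mono_step_fun[of "min u 0" u] mono_step_fun[of u "max u 1"]
    step_fun_0[of "min u 0"] step_fun_1[of "max u 1"] by simp

lemma lipschitz_step_fun: "2-lipschitz_on UNIV step_fun"
proof (rule lipschitz_onI)
  fix u v :: real
  have "norm (step_fun u - step_fun v) \<le> 2 * norm (u - v)"
    by (rule field_differentiable_bound[of UNIV step_fun hat_fun])
       (use DERIV_step_fun hat_fun_bounds in auto)
  then show "dist (step_fun u) (step_fun v) \<le> 2 * dist u v" by (simp add: dist_norm)
qed simp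

section \<open>The divergence theorem in one boundary chart\<close>

lemma C1_closure_divergence:
  assumes "C1_closure \<Omega> F" "bounded \<Omega>"
  shows "continuous_on \<Omega> (divergence F)" "\<exists>B>0. \<forall>y\<in>\<Omega>. \<bar>divergence F y\<bar> \<le> B"
proof -
  obtain F' where F': "continuous_on (closure \<Omega>) F'" "\<And>x. x \<in> \<Omega> \<Longrightarrow> (F has_derivative blinfun_apply (F' x)) (at x)"
    using assms(1) by (auto simp: C1_closure_def)
  have cont: "continuous_on (closure \<Omega>) (\<lambda>x. \<Sum>b\<in>Basis. F' x b \<bullet> b)"
    by (intro continuous_intros F'(1))
  have eq: "divergence F x = (\<Sum>b\<in>Basis. F' x b \<bullet> b)" if "x \<in> \<Omega>" for x
    by (rule divergence_eq[OF F'(2)[OF that]])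
  show "continuous_on \<Omega> (divergence F)"
    using continuous_on_subset[OF cont closure_subset] by (subst continuous_on_cong[OF refl eq])
  have "bounded ((\<lambda>x. \<Sum>b\<in>Basis. F' x b \<bullet> b) ` closure \<Omega>)"
    using assms(2) by (intro compact_imp_bounded compact_continuous_image cont) auto
  then obtain B where B: "B > 0" "\<And>x. x \<in> closure \<Omega> \<Longrightarrow> \<bar>\<Sum>b\<in>Basis. F' x b \<bullet> b\<bar> \<le> B"
    by (auto simp: bounded_pos)
  show "\<exists>B>0. \<forall>y\<in>\<Omega>. \<bar>divergence F y\<bar> \<le> B"
    using B closure_subset[of \<Omega>] by (intro exI[of _ B]) (auto simp: eq subset_iff)
qed

text \<open>The support \<open>K\<close> lies in the chart but may cross the boundary; only its part
  at depth at least \<open>1 / Suc n\<close> is a compact subset of \<open>\<Omega>\<close>, which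
  is why a cutoff in the depth is inserted and then removed in the limit.\<close>

lemma integral_divergence_chart:
  fixes \<Omega> :: "'a::euclidean_space set" and H :: "'a \<Rightarrow> 'a"
  assumes \<Omega>: "open \<Omega>" "bounded \<Omega>" and chart: "lipschitz_chart \<Omega> U e \<gamma>"
    and H: "C1_closure \<Omega> H" and K: "compact K" "K \<subseteq> U"
    and supp: "\<And>y. y \<in> closure \<Omega> - K \<Longrightarrow> H y = 0"
    and tang: "\<And>x n. x \<in> frontier \<Omega> \<Longrightarrow> outward_unit_normal \<Omega> x n \<Longrightarrow> n \<bullet> H x = 0"
  shows "(\<integral>y. indicator \<Omega> y *\<^sub>R divergence H y \<partial>lborel) = 0"
proof -
  obtain L where U: "open U" and e: "norm e = 1" and L: "L-lipschitz_on UNIV \<gamma>"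
    and \<Omega>U: "\<Omega> \<inter> U = {y \<in> U. y \<bullet> e < \<gamma> (y - (y \<bullet> e) *\<^sub>R e)}"
    using chart unfolding lipschitz_chart_def by blast
  have ee: "e \<bullet> e = 1" using e by (simp add: norm_eq_1)
  have L0: "L \<ge> 0" by (rule lipschitz_on_nonneg[OF L])
  define g where "g y = \<gamma> (y - (y \<bullet> e) *\<^sub>R e)" for y
  \<comment> \<open>The depth below the graph along \<open>e\<close>. Unlike the distance to the
    boundary, it falls at unit rate along \<open>e\<close>, and its gradient is constant along
    \<open>e\<close>.\<close>
  define s where "s y = g y - y \<bullet> e" for y
  have in_\<Omega>: "y \<in> \<Omega> \<longleftrightarrow> s y > 0" if "y \<in> U" for y
    using \<Omega>U that by (auto simp: s_def g_def)
  have g_shift: "g (y + t *\<^sub>R e) = g y" for y t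
    by (simp add: g_def ee inner_add_left algebra_simps)
  have s_shift: "s (y + t *\<^sub>R e) = s y - t" for y t
    by (simp add: s_def g_shift ee inner_add_left)
  have g_lip: "L-lipschitz_on UNIV g"
  proof (rule lipschitz_onI)
    fix x y :: 'a
    define z where "z = x - y"
    \<comment> \<open>Pythagoras: the projection orthogonal to \<open>e\<close> does not increase
      norms, so \<open>g\<close> inherits the constant of \<open>\<gamma>\<close>.\<close>
    have "(norm (z - (z \<bullet> e) *\<^sub>R e))\<^sup>2 = (norm z)\<^sup>2 - (z \<bullet> e)\<^sup>2"
      by (simp only: power2_norm_eq_inner)
         (simp add: inner_diff_left inner_diff_right ee inner_commute[of e z] power2_eq_square)
    then have "(norm (z - (z \<bullet> e) *\<^sub>R e))\<^sup>2 \<le> (norm z)\<^sup>2"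
      using zero_le_power2[of "z \<bullet> e"] by linarith
    then have nz: "norm (z - (z \<bullet> e) *\<^sub>R e) \<le> norm z"
      by (rule power2_le_imp_le) (rule norm_ge_zero)
    have "dist (g x) (g y) \<le> L * dist (x - (x \<bullet> e) *\<^sub>R e) (y - (y \<bullet> e) *\<^sub>R e)"
      unfolding g_def by (rule lipschitz_onD[OF L]) auto
    also have "\<dots> \<le> L * dist x y"
    proof (intro mult_left_mono L0)
      have "x - (x \<bullet> e) *\<^sub>R e - (y - (y \<bullet> e) *\<^sub>R e) = z - (z \<bullet> e) *\<^sub>R e"
        by (simp add: z_def algebra_simps)
      then show "dist (x - (x \<bullet> e) *\<^sub>R e) (y - (y \<bullet> e) *\<^sub>R e) \<le> dist x y"
        using nz by (simp only: dist_norm z_def[symmetric])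
    qed
    finally show "dist (g x) (g y) \<le> L * dist x y" .
  qed (rule L0)
  have s_lip: "(L + 1)-lipschitz_on UNIV s"
    unfolding s_def
  proof (intro lipschitz_on_diff g_lip lipschitz_onI)
    show "dist (x \<bullet> e) (y \<bullet> e) \<le> 1 * dist x y" for x y :: 'a
      using Cauchy_Schwarz_ineq2[of "x - y" e] e by (simp add: dist_norm inner_diff_left)
  qed simp
  have cs: "continuous_on UNIV s" using s_lip by (rule lipschitz_on_continuous_on)
  have sm[measurable]: "s \<in> borel_measurable borel" by (rule borel_measurable_continuous_onI[OF cs])
  obtain gg where gg[measurable]: "gg \<in> borel_measurable borel" and gg_deriv: "AE y in lborel. GDERIV g y :> gg y"
    using rademacher[OF g_lip] by blast
  obtain H' where H': "continuous_on (closure \<Omega>) H'" "\<And>x. x \<in> \<Omega> \<Longrightarrow> (H has_derivative blinfun_apply (H' x)) (at x)"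
    and cH: "continuous_on (closure \<Omega>) H"
    using H by (auto simp: C1_closure_def)
  obtain B where B: "B > 0" "\<And>y. y \<in> \<Omega> \<Longrightarrow> \<bar>divergence H y\<bar> \<le> B"
    using C1_closure_divergence(2)[OF H \<Omega>(2)] by blast
  have cdiv: "continuous_on \<Omega> (divergence H)" by (rule C1_closure_divergence(1)[OF H \<Omega>(2)])
  have [measurable]: "(\<lambda>y. indicator \<Omega> y *\<^sub>R divergence H y) \<in> borel_measurable borel"
    "(\<lambda>y. indicator \<Omega> y *\<^sub>R H y) \<in> borel_measurable borel"
    by (intro borel_measurable_continuous_on_indicator cdiv continuous_on_subset[OF cH closure_subset]; use \<Omega> in simp)+
  have cpt: "compact (closure \<Omega>)" using \<Omega>(2) by auto
  obtain BH where BH: "BH > 0" "\<And>y. y \<in> closure \<Omega> \<Longrightarrow> norm (H y) \<le> BH"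
    using compact_imp_bounded[OF compact_continuous_image[OF cH cpt]] by (auto simp: bounded_pos)
  obtain R where R: "R > 0" "\<And>y. y \<in> \<Omega> \<Longrightarrow> norm y \<le> R"
    using \<Omega>(2) by (auto simp: bounded_pos)
  have int\<Omega>: "integrable lborel (\<lambda>y. indicator \<Omega> y * C)" for C :: real
    using emeasure_bounded_finite[OF \<Omega>(2)] \<Omega>(1)
    by (intro integrable_mult_left) (simp add: integrable_indicator_iff)

  \<comment> \<open>The cutoff is 0 up to depth \<open>1 / Suc n\<close> and 1 from depth
    \<open>2 / Suc n\<close> on; \<open>c n\<close> is its gradient wherever \<open>g\<close> has
    gradient \<open>gg\<close>.\<close>
  define \<zeta> where "\<zeta> n y = step_fun (real (Suc n) * s y - 1)" for n y
  define c where "c n y = (hat_fun (real (Suc n) * s y - 1) * real (Suc n)) *\<^sub>R (gg y - e)" for n y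
  have [measurable]: "\<zeta> n \<in> borel_measurable borel" "c n \<in> borel_measurable borel" for n
  proof -
    have [measurable]: "step_fun \<in> borel_measurable borel" "hat_fun \<in> borel_measurable borel"
      using lipschitz_on_continuous_on[OF lipschitz_step_fun] continuous_on_hat_fun
      by (auto intro: borel_measurable_continuous_onI)
    show "\<zeta> n \<in> borel_measurable borel" "c n \<in> borel_measurable borel"
      by (simp_all add: \<zeta>_def[abs_def] c_def[abs_def])
  qed
  have c_deriv: "GDERIV (\<zeta> n) y :> c n y" if "GDERIV g y :> gg y" for n y
  proof -
    have "GDERIV (\<lambda>y. real (Suc n) * s y - 1) y :> real (Suc n) *\<^sub>R (gg y - e)"
      using that unfolding gderiv_def s_def
      by (auto intro!: derivative_eq_intros simp: inner_diff_right algebra_simps)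
    from GDERIV_DERIV_compose[OF this DERIV_step_fun] show ?thesis
      by (simp add: \<zeta>_def[abs_def] c_def)
  qed
  have zero: "(\<integral>y. indicator \<Omega> y *\<^sub>R (\<zeta> n y * divergence H y + c n y \<bullet> H y) \<partial>lborel) = 0" for n
  proof (rule integral_divergence_compact_support[where K = "K \<inter> {y. s y \<ge> 1 / real (Suc n)}"
        and X = 1 and M = "2 * (real (Suc n) * (L + 1))"])
    show "continuous_on \<Omega> H'" using H'(1) closure_subset by (rule continuous_on_subset)
    show "compact (K \<inter> {y. s y \<ge> 1 / real (Suc n)})"
      by (intro compact_Int_closed K(1) closed_Collect_le continuous_intros cs)
    show "K \<inter> {y. s y \<ge> 1 / real (Suc n)} \<subseteq> \<Omega>"
    proof
      fix y assume y: "y \<in> K \<inter> {y. s y \<ge> 1 / real (Suc n)}"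
      then have "s y > 0" by (smt (verit) IntD2 mem_Collect_eq of_nat_0_less_iff zero_less_Suc zero_less_divide_1_iff)
      then show "y \<in> \<Omega>" using y K(2) in_\<Omega> by blast
    qed
    show "(2 * (real (Suc n) * (L + 1)))-lipschitz_on UNIV (\<zeta> n)"
    proof (rule lipschitz_onI)
      fix x y :: 'a
      have "dist (\<zeta> n x) (\<zeta> n y) \<le> 2 * dist (real (Suc n) * s x - 1) (real (Suc n) * s y - 1)"
        unfolding \<zeta>_def by (rule lipschitz_onD[OF lipschitz_step_fun]) auto
      also have "dist (real (Suc n) * s x - 1) (real (Suc n) * s y - 1) = real (Suc n) * dist (s x) (s y)"
        by (simp add: dist_real_def right_diff_distrib[symmetric] abs_mult del: of_nat_Suc)
      also have "dist (s x) (s y) \<le> (L + 1) * dist x y" by (rule lipschitz_onD[OF s_lip]) auto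
      finally show "dist (\<zeta> n x) (\<zeta> n y) \<le> 2 * (real (Suc n) * (L + 1)) * dist x y"
        by (simp add: mult.assoc mult_left_mono del: of_nat_Suc)
    qed (use L0 in simp)
    show "\<bar>\<zeta> n y\<bar> \<le> 1" for y by (simp add: \<zeta>_def step_fun_abs_le)
    show "AE y in lborel. GDERIV (\<zeta> n) y :> c n y" using gg_deriv by eventually_elim (rule c_deriv)
    show "\<zeta> n y *\<^sub>R H y = 0" if y: "y \<in> \<Omega> - K \<inter> {y. s y \<ge> 1 / real (Suc n)}" for y
    proof (cases "y \<in> K")
      case True
      then have "real (Suc n) * s y - 1 \<le> 0" using y by (auto simp: field_simps)
      then show ?thesis by (simp add: \<zeta>_def step_fun_0)
    next
      case False
      then show ?thesis using supp[of y] y closure_subset by auto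
    qed
  qed (use \<Omega> H'(2) in auto)

  define Lay where "Lay n = {y \<in> cball 0 R. 1 / real (Suc n) < s y \<and> s y < 2 / real (Suc n)}" for n
  have Lay_m[measurable]: "Lay n \<in> sets borel" for n unfolding Lay_def by measurable
  have Lay_int: "integrable lborel (\<lambda>y. indicator (Lay n) y * C)" for n and C :: real
  proof -
    have "bounded (Lay n)"
      by (rule bounded_subset[OF bounded_cball[of 0 R]]) (auto simp: Lay_def)
    from emeasure_bounded_finite[OF this] show ?thesis
      by (intro integrable_mult_left) (simp add: integrable_indicator_iff)
  qed
  define V where "V = measure lebesgue (cball (0::'a) (R + 1))"
  have V: "V \<ge> 0" by (simp add: V_def)
  have Lay_V: "measure lborel (Lay n) \<le> V / real (Suc n)" for n
    using measure_layer_le[OF cs s_shift e, of "Suc n" R] Lay_m[of n]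
    by (simp add: Lay_def V_def measure_completion)
  have c_norm: "norm (c n y) \<le> indicator {y. 1 / real (Suc n) < s y \<and> s y < 2 / real (Suc n)} y * (2 * real (Suc n) * (L + 1))"
    if "GDERIV g y :> gg y" for n y
  proof (cases "hat_fun (real (Suc n) * s y - 1) = 0")
    case True
    then show ?thesis using L0 by (simp add: c_def)
  next
    case False
    then have "0 < real (Suc n) * s y - 1 \<and> real (Suc n) * s y - 1 < 1" by (rule hat_fun_support)
    then have lay: "1 / real (Suc n) < s y \<and> s y < 2 / real (Suc n)" by (simp add: field_simps)
    have "norm (gg y - e) \<le> L + 1"
      using norm_triangle_ineq4[of "gg y" e] GDERIV_lipschitz_norm_le[OF g_lip that] e by simp
    moreover have "\<bar>hat_fun (real (Suc n) * s y - 1) * real (Suc n)\<bar> \<le> 2 * real (Suc n)"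
      using hat_fun_bounds by (simp add: abs_mult del: of_nat_Suc)
    ultimately have "norm (c n y) \<le> 2 * real (Suc n) * (L + 1)"
      unfolding c_def norm_scaleR real_norm_def by (intro mult_mono) auto
    then show ?thesis using lay by simp
  qed
  have c_norm': "norm (c n y) \<le> 2 * real (Suc n) * (L + 1)" if "GDERIV g y :> gg y" for n y
    by (rule order_trans[OF c_norm[OF that]]) (use L0 in \<open>simp add: mult_left_le_one_le del: of_nat_Suc\<close>)
  \<comment> \<open>The factor \<open>real (Suc n)\<close> will be cancelled by the volume of the
    layer, so the whole gain is \<open>\<eta>\<close>: the variation of \<open>H\<close> between
    \<open>y\<close> and the boundary point above it.\<close>
  have near: "\<forall>\<^sub>F n in sequentially. \<forall>y. GDERIV g y :> gg y \<longrightarrow>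
      \<bar>indicator \<Omega> y *\<^sub>R (c n y \<bullet> H y)\<bar> \<le> indicator (Lay n) y * (2 * real (Suc n) * (L + 1) * \<eta>)"
    if \<eta>: "\<eta> > 0" for \<eta>
  proof -
    have "uniformly_continuous_on (closure \<Omega>) H" using cH cpt by (rule compact_uniformly_continuous)
    then obtain \<delta> where \<delta>: "\<delta> > 0" "\<And>x x'. x \<in> closure \<Omega> \<Longrightarrow> x' \<in> closure \<Omega> \<Longrightarrow> dist x' x < \<delta> \<Longrightarrow> dist (H x') (H x) < \<eta>"
      using \<eta> unfolding uniformly_continuous_on_def by metis
    obtain r where r: "r > 0" "(\<Union>y\<in>K. cball y r) \<subseteq> U"
      using compact_subset_open_imp_cball_epsilon_subset[OF K(1) U K(2)] by blast
    have "(\<lambda>n. 2 / real (Suc n)) \<longlonglongrightarrow> 0"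
      using tendsto_mult[OF tendsto_const[of 2] LIMSEQ_Suc[OF lim_1_over_n]] by simp
    moreover have "0 < min \<delta> r" using \<delta>(1) r(1) by simp
    ultimately have "\<forall>\<^sub>F n in sequentially. 2 / real (Suc n) < min \<delta> r" by (rule order_tendstoD)
    then show ?thesis
    proof eventually_elim
      case (elim n)
      show ?case
      proof (intro allI impI)
        fix y assume D: "GDERIV g y :> gg y"
        show "\<bar>indicator \<Omega> y *\<^sub>R (c n y \<bullet> H y)\<bar> \<le> indicator (Lay n) y * (2 * real (Suc n) * (L + 1) * \<eta>)"
        proof (cases "y \<in> \<Omega> \<and> y \<in> K \<and> c n y \<noteq> 0")
          case True
          then have y: "y \<in> \<Omega>" "y \<in> K" "c n y \<noteq> 0" by auto
          have lay': "1 / real (Suc n) < s y \<and> s y < 2 / real (Suc n)"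
          proof (rule ccontr)
            assume "\<not> ?thesis"
            then have "norm (c n y) \<le> 0" using c_norm[OF D, of n] by (simp only: indicator_def mem_Collect_eq of_bool_eq if_False mult_zero_left)
            then show False using y(3) by simp
          qed
          then have lay: "1 / real (Suc n) < s y" "s y < 2 / real (Suc n)" by blast+
          then have "y \<in> Lay n" using R(2) y(1) by (simp add: Lay_def)
          have "1 / real (Suc n) > 0" by simp
          then have s_pos: "s y > 0" using lay(1) by linarith
          \<comment> \<open>The boundary point above \<open>y\<close>. Its distance from
            \<open>y\<close> is the depth, which for large \<open>n\<close> keeps it in
            \<open>U\<close> and within the range where \<open>H\<close> varies by less than
            \<open>\<eta>\<close>.\<close>
          define x where "x = y + s y *\<^sub>R e"
          have dist_xy: "dist y x = s y" using e s_pos by (simp add: x_def dist_norm)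
          have xU: "x \<in> U" using r(2) y(2) dist_xy lay(2) elim by force
          have sx: "s x = 0" by (simp add: x_def s_shift)
          have "x \<notin> \<Omega>" using in_\<Omega>[OF xU] sx by simp
          moreover have "x \<in> closure \<Omega>"
            unfolding closure_approachable
          proof (intro allI impI)
            fix a :: real assume "a > 0"
            obtain \<rho> where \<rho>: "\<rho> > 0" "ball x \<rho> \<subseteq> U" using U xU open_contains_ball by blast
            define t where "t = min a \<rho> / 2"
            have t: "t > 0" "t < a" "t < \<rho>" using \<open>a > 0\<close> \<rho>(1) by (auto simp: t_def)
            have "dist (x + (- t) *\<^sub>R e) x = t" using e t(1) by (simp add: dist_norm)
            moreover from this have "x + (- t) *\<^sub>R e \<in> U" using \<rho>(2) t(3) by (auto simp: dist_commute)
            moreover have "s (x + (- t) *\<^sub>R e) > 0" using s_shift[of x "- t"] sx t(1) by simp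
            ultimately show "\<exists>z\<in>\<Omega>. dist z x < a" using in_\<Omega> t(2) by force
          qed
          ultimately have x: "x \<in> frontier \<Omega>" "x \<in> closure \<Omega>"
            using \<Omega>(1) by (auto simp: frontier_def interior_open)
          \<comment> \<open>Translation along \<open>e\<close> leaves \<open>g\<close> unchanged, so
            differentiability at \<open>y\<close> carries over to \<open>x\<close> with the same
            gradient.\<close>
          have gx: "GDERIV g x :> gg y"
          proof -
            have "(g has_derivative (\<lambda>h. h \<bullet> gg y)) (at (x + (- s y) *\<^sub>R e))"
              using D by (simp add: gderiv_def x_def)
            moreover have "((\<lambda>z. z + (- s y) *\<^sub>R e) has_derivative (\<lambda>h. h)) (at x)"
              by (auto intro!: derivative_eq_intros)
            ultimately have "((\<lambda>z. g (z + (- s y) *\<^sub>R e)) has_derivative (\<lambda>h. h \<bullet> gg y)) (at x)"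
              by (rule has_derivative_compose[rotated])
            then show ?thesis by (simp only: g_shift gderiv_def)
          qed
          have "GDERIV (\<lambda>z. z \<bullet> e - \<gamma> (z - (z \<bullet> e) *\<^sub>R e)) x :> e - gg y"
            using gx unfolding gderiv_def g_def[abs_def, symmetric]
            by (auto intro!: derivative_eq_intros simp: inner_diff_right g_def[symmetric])
          then have "outward_unit_normal \<Omega> x (sgn (e - gg y))"
            unfolding outward_unit_normal_def using x(1) xU chart by blast
          then have "sgn (e - gg y) \<bullet> H x = 0" using tang x(1) by blast
          then have "(e - gg y) \<bullet> H x = 0" by (auto simp: sgn_div_norm)
          then have "(gg y - e) \<bullet> H x = 0" by (simp add: inner_diff_left)
          then have "c n y \<bullet> H x = 0" by (simp add: c_def)
          then have "c n y \<bullet> H y = c n y \<bullet> (H y - H x)" by (simp add: inner_diff_right)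
          also have "\<bar>\<dots>\<bar> \<le> norm (c n y) * norm (H y - H x)" by (rule Cauchy_Schwarz_ineq2)
          also have "\<dots> \<le> (2 * real (Suc n) * (L + 1)) * \<eta>"
          proof (intro mult_mono)
            show "norm (c n y) \<le> 2 * real (Suc n) * (L + 1)"
              by (rule c_norm'[OF D])
            show "norm (H y - H x) \<le> \<eta>"
              using \<delta>(2)[OF x(2), of y] y(1) closure_subset dist_xy lay(2) elim by (force simp: dist_norm)
          qed (use L0 in auto)
          finally show ?thesis using y(1) \<open>y \<in> Lay n\<close> by simp
        next
          case False
          then have "indicator \<Omega> y *\<^sub>R (c n y \<bullet> H y) = 0"
            using supp[of y] closure_subset[of \<Omega>] by (auto simp: indicator_def)
          then show ?thesis using L0 \<eta> by (simp only: abs_zero) (simp del: of_nat_Suc)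
        qed
      qed
    qed
  qed
  have int1: "integrable lborel (\<lambda>y. indicator \<Omega> y *\<^sub>R (\<zeta> n y * divergence H y))" for n
  proof (rule Bochner_Integration.integrable_bound[OF int\<Omega>[of B]])
    have eq: "(\<lambda>y. indicator \<Omega> y *\<^sub>R (\<zeta> n y * divergence H y)) = (\<lambda>y. \<zeta> n y * (indicator \<Omega> y *\<^sub>R divergence H y))"
      by auto
    show "(\<lambda>y. indicator \<Omega> y *\<^sub>R (\<zeta> n y * divergence H y)) \<in> borel_measurable lborel"
      unfolding eq by measurable
    show "AE y in lborel. norm (indicator \<Omega> y *\<^sub>R (\<zeta> n y * divergence H y)) \<le> norm (indicator \<Omega> y * B)"
      using B mult_mono[OF step_fun_abs_le B(2)] by (intro AE_I2) (auto simp: indicator_def abs_mult \<zeta>_def)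
  qed
  have int2: "integrable lborel (\<lambda>y. indicator \<Omega> y *\<^sub>R (c n y \<bullet> H y))" for n
  proof (rule Bochner_Integration.integrable_bound[OF int\<Omega>[of "2 * real (Suc n) * (L + 1) * BH"]])
    have eq: "(\<lambda>y. indicator \<Omega> y *\<^sub>R (c n y \<bullet> H y)) = (\<lambda>y. c n y \<bullet> (indicator \<Omega> y *\<^sub>R H y))" by auto
    show "(\<lambda>y. indicator \<Omega> y *\<^sub>R (c n y \<bullet> H y)) \<in> borel_measurable lborel"
      unfolding eq by measurable
    show "AE y in lborel. norm (indicator \<Omega> y *\<^sub>R (c n y \<bullet> H y)) \<le> norm (indicator \<Omega> y * (2 * real (Suc n) * (L + 1) * BH))"
      using gg_deriv
    proof eventually_elim
      case (elim y)
      show ?case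
      proof (cases "y \<in> \<Omega>")
        case True
        have "\<bar>c n y \<bullet> H y\<bar> \<le> norm (c n y) * norm (H y)" by (rule Cauchy_Schwarz_ineq2)
        also have "\<dots> \<le> 2 * real (Suc n) * (L + 1) * BH"
          using c_norm'[OF elim, of n] BH(2)[of y] True closure_subset[of \<Omega>] L0
          by (intro mult_mono) auto
        finally show ?thesis using True by simp
      qed simp
    qed
  qed
  have sum0: "(\<integral>y. indicator \<Omega> y *\<^sub>R (\<zeta> n y * divergence H y) \<partial>lborel) + (\<integral>y. indicator \<Omega> y *\<^sub>R (c n y \<bullet> H y) \<partial>lborel) = 0" for n
    using zero[of n] by (simp only: scaleR_add_right Bochner_Integration.integral_add[OF int1 int2])
  have lim2: "(\<lambda>n. \<integral>y. indicator \<Omega> y *\<^sub>R (c n y \<bullet> H y) \<partial>lborel) \<longlonglongrightarrow> 0"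
  proof (rule tendstoI)
    fix \<epsilon> :: real assume "\<epsilon> > 0"
    \<comment> \<open>The layer volume \<open>V / Suc n\<close> times the gradient bound
      \<open>2 * Suc n * (L + 1)\<close> is \<open>2 * V * (L + 1)\<close>; the added 1 keeps the
      denominator positive and the last inequality strict.\<close>
    define \<eta> where "\<eta> = \<epsilon> / (2 * V * (L + 1) + 1)"
    have den: "2 * V * (L + 1) + 1 > 0" using V L0 by (simp add: add_nonneg_pos)
    then have "\<eta> > 0" using \<open>\<epsilon> > 0\<close> by (simp add: \<eta>_def)
    from near[OF this]
    show "\<forall>\<^sub>F n in sequentially. dist (\<integral>y. indicator \<Omega> y *\<^sub>R (c n y \<bullet> H y) \<partial>lborel) 0 < \<epsilon>"
    proof eventually_elim
      case (elim n)
      have "norm (\<integral>y. indicator \<Omega> y *\<^sub>R (c n y \<bullet> H y) \<partial>lborel)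
          \<le> (\<integral>y. indicator (Lay n) y * (2 * real (Suc n) * (L + 1) * \<eta>) \<partial>lborel)"
      proof (rule order_trans[OF Bochner_Integration.integral_norm_bound])
        show "(\<integral>y. norm (indicator \<Omega> y *\<^sub>R (c n y \<bullet> H y)) \<partial>lborel)
          \<le> (\<integral>y. indicator (Lay n) y * (2 * real (Suc n) * (L + 1) * \<eta>) \<partial>lborel)"
        proof (rule integral_mono_AE[OF integrable_norm[OF int2] Lay_int])
          show "AE y in lborel. norm (indicator \<Omega> y *\<^sub>R (c n y \<bullet> H y)) \<le> indicator (Lay n) y * (2 * real (Suc n) * (L + 1) * \<eta>)"
            using gg_deriv by eventually_elim (use elim in \<open>simp only: real_norm_def\<close>)
        qed
      qed
      also have "\<dots> = measure lborel (Lay n) * (2 * real (Suc n) * (L + 1) * \<eta>)" by simp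
      also have "\<dots> \<le> V / real (Suc n) * (2 * real (Suc n) * (L + 1) * \<eta>)"
        using Lay_V[of n] L0 \<open>\<eta> > 0\<close> by (intro mult_right_mono) auto
      also have "\<dots> = 2 * V * (L + 1) * \<eta>" by (simp del: of_nat_Suc)
      also have "\<dots> < (2 * V * (L + 1) + 1) * \<eta>" using \<open>\<eta> > 0\<close> by (simp add: distrib_right)
      also have "\<dots> = \<epsilon>" using den by (simp add: \<eta>_def)
      finally show ?case by simp
    qed
  qed
  have lim1: "(\<lambda>n. \<integral>y. indicator \<Omega> y *\<^sub>R (\<zeta> n y * divergence H y) \<partial>lborel) \<longlonglongrightarrow> (\<integral>y. indicator \<Omega> y *\<^sub>R divergence H y \<partial>lborel)"
  proof (rule integral_dominated_convergence[OF _ _ int\<Omega>[of B]])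
    show "(\<lambda>y. indicator \<Omega> y *\<^sub>R (\<zeta> n y * divergence H y)) \<in> borel_measurable lborel" for n
      using int1 by auto
    show "AE y in lborel. norm (indicator \<Omega> y *\<^sub>R (\<zeta> n y * divergence H y)) \<le> indicator \<Omega> y * B" for n
      using mult_mono[OF step_fun_abs_le B(2)] by (intro AE_I2) (auto simp: indicator_def abs_mult \<zeta>_def)
    show "AE y in lborel. (\<lambda>n. indicator \<Omega> y *\<^sub>R (\<zeta> n y * divergence H y)) \<longlonglongrightarrow> indicator \<Omega> y *\<^sub>R divergence H y"
    proof (intro AE_I2 tendsto_eventually)
      fix y
      show "\<forall>\<^sub>F n in sequentially. indicator \<Omega> y *\<^sub>R (\<zeta> n y * divergence H y) = indicator \<Omega> y *\<^sub>R divergence H y"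
      proof (cases "y \<in> \<Omega> \<and> y \<in> K")
        case True
        \<comment> \<open>Positive depth means that the cutoff at this fixed point is eventually
          equal to 1.\<close>
        then have "s y > 0" using in_\<Omega> K(2) by blast
        have "\<forall>\<^sub>F n in sequentially. 2 / s y \<le> real (Suc n)"
          by (rule eventually_sequentiallyI[of "nat \<lceil>2 / s y\<rceil>"]) linarith
        then show ?thesis
        proof eventually_elim
          case (elim n)
          then have "1 \<le> real (Suc n) * s y - 1" using \<open>s y > 0\<close> by (simp add: pos_divide_le_eq)
          then show ?case by (simp add: \<zeta>_def step_fun_1)
        qed
      next
        case False
        have "divergence H y = 0" if y: "y \<in> \<Omega>" "y \<notin> K"
        proof -
          have op: "open (\<Omega> - K)" using \<Omega>(1) K(1) compact_imp_closed by blast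
          have "((\<lambda>_. 0) has_derivative (\<lambda>_. 0 :: 'a)) (at y)" by simp
          moreover note op
          moreover have "y \<in> \<Omega> - K" using y by simp
          ultimately have "(H has_derivative (\<lambda>_. 0)) (at y)"
            by (rule has_derivative_transform_within_open) (metis DiffD1 DiffD2 DiffI closure_subset subsetD supp)
          from divergence_eq[OF this] show ?thesis by simp
        qed
        then show ?thesis using False by (auto simp: indicator_def)
      qed
    qed
  qed measurable
  from tendsto_add[OF lim1 lim2] have "(\<lambda>n. 0) \<longlonglongrightarrow> (\<integral>y. indicator \<Omega> y *\<^sub>R divergence H y \<partial>lborel)"
    by (simp only: sum0 add_0_right)
  then show ?thesis by (simp add: LIMSEQ_const_iff)
qed

section \<open>Calculus of functions and fields that are C1 up to the boundary\<close>

lemma C1_closure_imp_continuous_on: "C1_closure \<Omega> F \<Longrightarrow> continuous_on (closure \<Omega>) F"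
  by (simp add: C1_closure_def)

lemma C1_closure_const: "C1_closure \<Omega> (\<lambda>_. c)"
  unfolding C1_closure_def
  by (intro conjI exI[of _ "\<lambda>_. 0"]) (auto simp: zero_blinfun.rep_eq)

lemma C1_closure_scaleR:
  assumes "C1_closure \<Omega> u" "C1_closure \<Omega> F"
  shows "C1_closure \<Omega> (\<lambda>x. u x *\<^sub>R F x)"
proof -
  obtain u' where u: "continuous_on (closure \<Omega>) u" "continuous_on (closure \<Omega>) u'"
    "\<And>x. x \<in> \<Omega> \<Longrightarrow> (u has_derivative blinfun_apply (u' x)) (at x)"
    using assms(1) by (auto simp: C1_closure_def)
  obtain F' where F: "continuous_on (closure \<Omega>) F" "continuous_on (closure \<Omega>) F'"
    "\<And>x. x \<in> \<Omega> \<Longrightarrow> (F has_derivative blinfun_apply (F' x)) (at x)"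
    using assms(2) by (auto simp: C1_closure_def)
  \<comment> \<open>The product rule as an operator-valued expression, so that continuity up to the
    boundary can be read off; the second summand sends \<open>h\<close> to
    \<open>u' x h *\<^sub>R F x\<close>.\<close>
  let ?D = "\<lambda>x. u x *\<^sub>R F' x + (blinfun_scaleR_left (F x) o\<^sub>L u' x)"
  have "continuous_on (closure \<Omega>) ?D"
    by (intro continuous_on_add continuous_on_scaleR u F
        bounded_bilinear.continuous_on[OF bounded_bilinear_blinfun_compose]
        bounded_linear.continuous_on[OF bounded_linear_blinfun_scaleR_left])
  moreover have "((\<lambda>x. u x *\<^sub>R F x) has_derivative blinfun_apply (?D x)) (at x)" if "x \<in> \<Omega>" for x
    by (rule has_derivative_eq_rhs[OF has_derivative_scaleR[OF u(3)[OF that] F(3)[OF that]]])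
       (simp add: fun_eq_iff plus_blinfun.rep_eq scaleR_blinfun.rep_eq)
  ultimately show ?thesis
    unfolding C1_closure_def using continuous_on_scaleR[OF u(1) F(1)] by blast
qed

lemma C1_closure_add:
  assumes "C1_closure \<Omega> F" "C1_closure \<Omega> G"
  shows "C1_closure \<Omega> (\<lambda>x. F x + G x)"
proof -
  obtain F' where F: "continuous_on (closure \<Omega>) F" "continuous_on (closure \<Omega>) F'"
    "\<And>x. x \<in> \<Omega> \<Longrightarrow> (F has_derivative blinfun_apply (F' x)) (at x)"
    using assms(1) by (auto simp: C1_closure_def)
  obtain G' where G: "continuous_on (closure \<Omega>) G" "continuous_on (closure \<Omega>) G'"
    "\<And>x. x \<in> \<Omega> \<Longrightarrow> (G has_derivative blinfun_apply (G' x)) (at x)"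
    using assms(2) by (auto simp: C1_closure_def)
  have "((\<lambda>x. F x + G x) has_derivative blinfun_apply (F' x + G' x)) (at x)" if "x \<in> \<Omega>" for x
    using has_derivative_add[OF F(3)[OF that] G(3)[OF that]] by (simp add: plus_blinfun.rep_eq)
  then show ?thesis
    unfolding C1_closure_def
    using continuous_on_add[OF F(1) G(1)] continuous_on_add[OF F(2) G(2)] by blast
qed

lemma C1_closure_diff:
  assumes "C1_closure \<Omega> F" "C1_closure \<Omega> G"
  shows "C1_closure \<Omega> (\<lambda>x. F x - G x)"
  using C1_closure_add[OF assms(1) C1_closure_scaleR[OF C1_closure_const[of \<Omega> "-1"] assms(2)]] by simp

lemma C1_closure_sum:
  assumes "\<And>i. i \<in> I \<Longrightarrow> C1_closure \<Omega> (F i)"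
  shows "C1_closure \<Omega> (\<lambda>x. \<Sum>i\<in>I. F i x)"
  using assms
proof (induction I rule: infinite_finite_induct)
  case (insert i I)
  then show ?case by (simp add: C1_closure_add)
qed (simp_all add: C1_closure_const)

text \<open>Differentiability of \<open>p\<close> is asked only at values that \<open>u\<close>
  takes on the closure, which admits \<open>inverse\<close> of a function that is positive
  there.\<close>

lemma C1_closure_compose:
  fixes u :: "'a::euclidean_space \<Rightarrow> real"
  assumes "C1_closure \<Omega> u"
    and p: "\<And>x. x \<in> closure \<Omega> \<Longrightarrow> (p has_real_derivative p' (u x)) (at (u x))"
      "continuous_on (u ` closure \<Omega>) p'"
  shows "C1_closure \<Omega> (\<lambda>x. p (u x))"
proof -
  obtain u' where u: "continuous_on (closure \<Omega>) u" "continuous_on (closure \<Omega>) u'"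
    "\<And>x. x \<in> \<Omega> \<Longrightarrow> (u has_derivative blinfun_apply (u' x)) (at x)"
    using assms(1) by (auto simp: C1_closure_def)
  have "continuous_on (u ` closure \<Omega>) p"
    using p(1) by (intro continuous_at_imp_continuous_on ballI) (auto intro: DERIV_isCont)
  then have cp: "continuous_on (closure \<Omega>) (\<lambda>x. p (u x))"
    using u(1) by (rule continuous_on_compose2) simp
  have "continuous_on (closure \<Omega>) (\<lambda>x. p' (u x) *\<^sub>R u' x)"
    by (intro continuous_on_scaleR u continuous_on_compose2[OF p(2) u(1)]) simp
  moreover have "((\<lambda>x. p (u x)) has_derivative blinfun_apply (p' (u x) *\<^sub>R u' x)) (at x)" if "x \<in> \<Omega>" for x
  proof -
    have "(p has_derivative (*) (p' (u x))) (at (u x))"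
      using p(1) that closure_subset unfolding has_field_derivative_def by blast
    from has_derivative_compose[OF u(3)[OF that] this] show ?thesis
      by (simp add: scaleR_blinfun.rep_eq)
  qed
  ultimately show ?thesis unfolding C1_closure_def using cp by blast
qed

lemma GDERIV_imp_C1_closure:
  fixes u :: "'a::euclidean_space \<Rightarrow> real"
  assumes "continuous_on (closure \<Omega>) u" "continuous_on (closure \<Omega>) g"
    and "\<And>x. x \<in> \<Omega> \<Longrightarrow> GDERIV u x :> g x"
  shows "C1_closure \<Omega> u"
  unfolding C1_closure_def
  using assms bounded_linear.continuous_on[OF bounded_linear_blinfun_inner_left assms(2)]
  by (intro conjI exI[of _ "\<lambda>x. blinfun_inner_left (g x)"]) (auto simp: gderiv_def blinfun_inner_left.rep_eq)

text \<open>Riesz representation in coordinates: the coefficients of the gradient are values of the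
  derivative on the basis, hence continuous up to the boundary.\<close>

lemma C1_closure_gradient:
  fixes u :: "'a::euclidean_space \<Rightarrow> real"
  assumes "C1_closure \<Omega> u"
  shows "\<exists>g. continuous_on (closure \<Omega>) g \<and> (\<forall>x\<in>\<Omega>. GDERIV u x :> g x)"
proof -
  obtain u' where u: "continuous_on (closure \<Omega>) u'"
    "\<And>x. x \<in> \<Omega> \<Longrightarrow> (u has_derivative blinfun_apply (u' x)) (at x)"
    using assms(1) by (auto simp: C1_closure_def)
  define g where "g x = (\<Sum>b\<in>Basis. u' x b *\<^sub>R b)" for x
  have "h \<bullet> g x = u' x h" for h x
  proof -
    have "u' x h = u' x (\<Sum>b\<in>Basis. (h \<bullet> b) *\<^sub>R b)" by (simp add: euclidean_representation)
    also have "\<dots> = h \<bullet> g x" by (simp add: g_def blinfun.sum_right blinfun.scaleR_right inner_sum_right mult.commute)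
    finally show ?thesis by simp
  qed
  then have "\<forall>x\<in>\<Omega>. GDERIV u x :> g x" using u(2) by (simp add: gderiv_def)
  moreover have "continuous_on (closure \<Omega>) g"
    unfolding g_def[abs_def] by (intro continuous_intros u(1))
  ultimately show ?thesis by blast
qed

lemma gradient_eq:
  assumes "GDERIV f x :> D"
  shows "gradient f x = D"
  unfolding gradient_def
proof (rule the_equality)
  show "GDERIV f x :> D" by (rule assms)
  fix D' assume "GDERIV f x :> D'"
  then have "(\<lambda>h. h \<bullet> D') = (\<lambda>h. h \<bullet> D)"
    using assms unfolding gderiv_def by (rule has_derivative_unique)
  then have "(D' - D) \<bullet> D' = (D' - D) \<bullet> D" by (rule fun_cong)
  then have "(D' - D) \<bullet> (D' - D) = 0" by (subst inner_diff_right) simp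
  then show "D' = D" by simp
qed

lemma divergence_scaleR:
  assumes "GDERIV u x :> g" "(F has_derivative F') (at x)"
  shows "divergence (\<lambda>y. u y *\<^sub>R F y) x = u x * divergence F x + g \<bullet> F x"
proof -
  have "((\<lambda>y. u y *\<^sub>R F y) has_derivative (\<lambda>h. u x *\<^sub>R F' h + (h \<bullet> g) *\<^sub>R F x)) (at x)"
    using assms unfolding gderiv_def by (rule has_derivative_scaleR)
  moreover have "(\<Sum>b\<in>Basis. (b \<bullet> g) * (F x \<bullet> b)) = g \<bullet> F x"
    by (subst euclidean_inner) (simp add: inner_commute)
  ultimately show ?thesis
    by (simp add: divergence_eq[OF assms(2)] divergence_eq inner_add_left sum.distrib sum_distrib_left)
qed

text \<open>Divergence is local, so under it \<open>gradient\<close> may be replaced by the field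
  that extends it continuously to the closure.\<close>

lemma divergence_cong:
  assumes "open S" "x \<in> S" "\<And>y. y \<in> S \<Longrightarrow> F y = G y" "F differentiable (at x)"
  shows "divergence G x = divergence F x"
proof -
  obtain D where D: "(F has_derivative D) (at x)" using assms(4) by (auto simp: differentiable_def)
  then have "(G has_derivative D) (at x)"
    using assms(1-3) by (rule has_derivative_transform_within_open)
  then show ?thesis using D by (simp add: divergence_eq)
qed

lemma C1_closure_differentiable:
  "C1_closure \<Omega> F \<Longrightarrow> x \<in> \<Omega> \<Longrightarrow> F differentiable (at x)"
  by (auto simp: C1_closure_def differentiable_def)

section \<open>Integrability, and the passage from charts to the whole domain\<close>

lemma set_integrable_continuous_on_closure:
  fixes f :: "'a::euclidean_space \<Rightarrow> real"
  assumes "open \<Omega>" "bounded \<Omega>" "continuous_on (closure \<Omega>) f"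
  shows "set_integrable lborel \<Omega> f"
proof -
  have "set_integrable lborel (closure \<Omega>) f"
    using borel_integrable_compact[of "closure \<Omega>" f] assms
    by (simp add: set_integrable_def indicator_def if_distrib cong: if_cong)
  then show ?thesis
    by (rule set_integrable_subset) (use assms closure_subset in auto)
qed

lemma set_integrable_divergence:
  assumes "open \<Omega>" "bounded \<Omega>" "C1_closure \<Omega> F"
  shows "set_integrable lborel \<Omega> (divergence F)"
proof -
  obtain F' where F': "continuous_on (closure \<Omega>) F'" "\<And>x. x \<in> \<Omega> \<Longrightarrow> (F has_derivative blinfun_apply (F' x)) (at x)"
    using assms(3) by (auto simp: C1_closure_def)
  have "set_integrable lborel \<Omega> (\<lambda>x. \<Sum>b\<in>Basis. F' x b \<bullet> b)"
    by (intro set_integrable_continuous_on_closure assms continuous_intros F'(1))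
  then show ?thesis
    using divergence_eq[OF F'(2)] by (simp cong: set_integrable_cong)
qed

text \<open>For positive \<open>r\<close> the bump is positive exactly on the open ball; squaring
  the positive part makes it C1 across the sphere.\<close>

lemma C1_closure_bump: "C1_closure \<Omega> (\<lambda>y. (max 0 (r\<^sup>2 - (y - x) \<bullet> (y - x)))\<^sup>2)"
proof (rule C1_closure_compose[where p = "\<lambda>t. (max 0 t)\<^sup>2" and p' = "\<lambda>t. 2 * max 0 t"
      and u = "\<lambda>y. r\<^sup>2 - (y - x) \<bullet> (y - x)"])
  show "C1_closure \<Omega> (\<lambda>y. r\<^sup>2 - (y - x) \<bullet> (y - x))"
    by (rule GDERIV_imp_C1_closure[where g = "\<lambda>y. - 2 *\<^sub>R (y - x)"])
       (auto intro!: continuous_intros derivative_eq_intros simp: gderiv_def algebra_simps inner_commute)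
qed (auto intro!: DERIV_max_0_squared continuous_intros)

theorem integral_divergence_eq_0:
  fixes \<Omega> :: "'a::euclidean_space set" and G :: "'a \<Rightarrow> 'a"
  assumes domain: "lipschitz_domain \<Omega>" "bounded \<Omega>" and G: "C1_closure \<Omega> G"
    and tang: "\<And>x n. x \<in> frontier \<Omega> \<Longrightarrow> outward_unit_normal \<Omega> x n \<Longrightarrow> n \<bullet> G x = 0"
  shows "(LINT x:\<Omega>|lborel. divergence G x) = 0"
proof -
  have op: "open \<Omega>" using domain(1) by (simp add: lipschitz_domain_def)
  \<comment> \<open>Tangency survives multiplication by scalar functions, so every piece of the
    partition of unity inherits it from \<open>G\<close>.\<close>
  define tangential where
    "tangential H \<longleftrightarrow> (\<forall>x\<in>frontier \<Omega>. \<forall>n. outward_unit_normal \<Omega> x n \<longrightarrow> n \<bullet> H x = 0)" for H :: "'a \<Rightarrow> 'a"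
  define supported where "supported H K \<longleftrightarrow> (\<forall>y\<in>closure \<Omega> - K. H y = 0)" for H :: "'a \<Rightarrow> 'a" and K
  \<comment> \<open>The radius is chosen before the field, so that a finite subcover can be
    extracted first and the pieces of \<open>G\<close> formed from it afterwards.\<close>
  have "\<forall>x\<in>closure \<Omega>. \<exists>r>0. \<forall>H. C1_closure \<Omega> H \<and> supported H (cball x r) \<and> tangential H \<longrightarrow>
      (LINT x:\<Omega>|lborel. divergence H x) = 0"
  proof
    fix x assume x: "x \<in> closure \<Omega>"
    show "\<exists>r>0. \<forall>H. C1_closure \<Omega> H \<and> supported H (cball x r) \<and> tangential H \<longrightarrow> (LINT x:\<Omega>|lborel. divergence H x) = 0"
    proof (cases "x \<in> \<Omega>")
      case True
      then obtain r where r: "r > 0" "cball x r \<subseteq> \<Omega>" using op open_contains_cball by blast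
      have "(LINT x:\<Omega>|lborel. divergence H x) = 0" if H: "C1_closure \<Omega> H" "supported H (cball x r)" for H
      proof -
        obtain H' where H': "continuous_on (closure \<Omega>) H'" "\<And>x. x \<in> \<Omega> \<Longrightarrow> (H has_derivative blinfun_apply (H' x)) (at x)"
          using H(1) by (auto simp: C1_closure_def)
        \<comment> \<open>Away from the boundary the trivial cutoff 1, with gradient 0, is
          sufficient.\<close>
        have "(\<integral>y. indicator \<Omega> y *\<^sub>R (1 * divergence H y + 0 \<bullet> H y) \<partial>lborel) = 0"
        proof (rule integral_divergence_compact_support[OF op H'(2) _ compact_cball r(2), where X = 1 and M = 0])
          show "continuous_on \<Omega> H'" using H'(1) closure_subset by (rule continuous_on_subset)
          show "1 *\<^sub>R H y = 0" if "y \<in> \<Omega> - cball x r" for y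
            using that H(2) closure_subset[of \<Omega>] by (auto simp: supported_def)
        qed (auto simp: gderiv_def lipschitz_on_def)
        then show ?thesis by (simp add: set_lebesgue_integral_def)
      qed
      then show ?thesis using r(1) by blast
    next
      case False
      then have "x \<in> frontier \<Omega>" using x op by (simp add: frontier_def interior_open)
      then obtain U e \<gamma> where U: "x \<in> U" "lipschitz_chart \<Omega> U e \<gamma>"
        using domain(1) unfolding lipschitz_domain_def by blast
      then have "open U" by (simp add: lipschitz_chart_def)
      then obtain r where r: "r > 0" "cball x r \<subseteq> U" using U(1) open_contains_cball by blast
      have "(LINT x:\<Omega>|lborel. divergence H x) = 0"
        if H: "C1_closure \<Omega> H" "supported H (cball x r)" "tangential H" for H
        unfolding set_lebesgue_integral_def
        by (rule integral_divergence_chart[OF op domain(2) U(2) H(1) compact_cball r(2)])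
           (use H(2,3) in \<open>auto simp: supported_def tangential_def\<close>)
      then show ?thesis using r(1) by blast
    qed
  qed
  then obtain r where r: "\<And>x. x \<in> closure \<Omega> \<Longrightarrow> r x > 0"
    "\<And>x H. x \<in> closure \<Omega> \<Longrightarrow> C1_closure \<Omega> H \<Longrightarrow> supported H (cball x (r x)) \<Longrightarrow> tangential H \<Longrightarrow>
        (LINT x:\<Omega>|lborel. divergence H x) = 0"
    by (metis bchoice)
  have "compact (closure \<Omega>)" using domain(2) by simp
  moreover have "closure \<Omega> \<subseteq> (\<Union>x\<in>closure \<Omega>. ball x (r x))" using r(1) by force
  ultimately obtain X where X: "X \<subseteq> closure \<Omega>" "finite X" "closure \<Omega> \<subseteq> (\<Union>x\<in>X. ball x (r x))"
    using compactE_image[of "closure \<Omega>" "closure \<Omega>" "\<lambda>x. ball x (r x)"] by auto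
  define b where "b x y = (max 0 ((r x)\<^sup>2 - (y - x) \<bullet> (y - x)))\<^sup>2" for x y
  have b_pos: "b x y > 0" if "y \<in> ball x (r x)" for x y
  proof -
    have "(norm (y - x))\<^sup>2 < (r x)\<^sup>2"
      using that by (intro power_strict_mono) (auto simp: dist_norm norm_minus_commute)
    then show ?thesis by (simp add: b_def power2_norm_eq_inner)
  qed
  have b_0: "b x y = 0" if "y \<notin> cball x (r x)" "x \<in> X" for x y
  proof -
    have "(r x)\<^sup>2 \<le> (norm (y - x))\<^sup>2"
      using that r(1)[of x] X(1) by (intro power_mono) (auto simp: dist_norm norm_minus_commute less_imp_le)
    then show ?thesis by (simp add: b_def power2_norm_eq_inner)
  qed
  \<comment> \<open>Division by this sum, positive on the closure by the covering, turns the bumps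
    into a partition of unity there.\<close>
  define S where "S y = (\<Sum>x\<in>X. b x y)" for y
  have S_pos: "S y > 0" if y: "y \<in> closure \<Omega>" for y
  proof -
    obtain x where x: "x \<in> X" "y \<in> ball x (r x)" using X(3) y by blast
    show ?thesis unfolding S_def
    proof (rule sum_pos2[OF X(2) x(1)])
      show "0 < b x y" by (rule b_pos[OF x(2)])
      show "0 \<le> b z y" for z by (simp add: b_def)
    qed
  qed
  have b_C1: "C1_closure \<Omega> (b x)" for x
    unfolding b_def[abs_def] by (rule C1_closure_bump)
  have S_C1: "C1_closure \<Omega> (\<lambda>y. inverse (S y))"
  proof (rule C1_closure_compose[where p = inverse and u = S and p' = "\<lambda>t. - inverse (t ^ 2)"])
    show "C1_closure \<Omega> S" unfolding S_def[abs_def] by (intro C1_closure_sum b_C1)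
    show "(inverse has_real_derivative - inverse ((S x)\<^sup>2)) (at (S x))" if "x \<in> closure \<Omega>" for x
      using DERIV_inverse[of "S x"] S_pos[OF that] by (simp add: power2_eq_square numeral_2_eq_2)
    show "continuous_on (S ` closure \<Omega>) (\<lambda>t. - inverse (t\<^sup>2))"
      using S_pos by (intro continuous_intros) force
  qed
  define H where "H x y = b x y *\<^sub>R (inverse (S y) *\<^sub>R G y)" for x y
  have H_C1: "C1_closure \<Omega> (H x)" for x
    unfolding H_def[abs_def] by (intro C1_closure_scaleR b_C1 S_C1 G)
  have H_0: "(LINT y:\<Omega>|lborel. divergence (H x) y) = 0" if "x \<in> X" for x
  proof (rule r(2)[OF _ H_C1])
    show "x \<in> closure \<Omega>" using X(1) that by blast
    show "supported (H x) (cball x (r x))"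
      using b_0 that by (auto simp: supported_def H_def)
    show "tangential (H x)" using tang by (simp add: tangential_def H_def)
  qed
  have "divergence G y = (\<Sum>x\<in>X. divergence (H x) y)" if y: "y \<in> \<Omega>" for y
  proof -
    have sum_H: "(\<Sum>x\<in>X. H x z) = G z" if "z \<in> \<Omega>" for z
    proof -
      have "z \<in> closure \<Omega>" using that closure_subset by blast
      then have "S z \<noteq> 0" using S_pos by fastforce
      have "(\<Sum>x\<in>X. b x z * inverse (S z)) = S z * inverse (S z)"
        by (simp add: S_def sum_distrib_right)
      then have "(\<Sum>x\<in>X. H x z) = (S z * inverse (S z)) *\<^sub>R G z"
        by (simp only: H_def scaleR_scaleR scaleR_left.sum[symmetric])
      then show ?thesis using \<open>S z \<noteq> 0\<close> by simp
    qed
    have "\<exists>D. \<forall>x. (H x has_derivative D x) (at y)"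
      using C1_closure_differentiable[OF H_C1 y] unfolding differentiable_def by metis
    then obtain D where D: "\<And>x. (H x has_derivative D x) (at y)" by blast
    have "((\<lambda>z. \<Sum>x\<in>X. H x z) has_derivative (\<lambda>h. \<Sum>x\<in>X. D x h)) (at y)"
      by (intro has_derivative_sum D)
    then have "(G has_derivative (\<lambda>h. \<Sum>x\<in>X. D x h)) (at y)"
      by (rule has_derivative_transform_within_open[OF _ op y]) (rule sum_H)
    then have "divergence G y = (\<Sum>b\<in>Basis. \<Sum>x\<in>X. D x b \<bullet> b)"
      by (simp add: divergence_eq inner_sum_left)
    also have "\<dots> = (\<Sum>x\<in>X. divergence (H x) y)"
      by (subst sum.swap) (simp add: divergence_eq[OF D])
    finally show ?thesis .
  qed
  then have "(LINT y:\<Omega>|lborel. divergence G y) = (LINT y:\<Omega>|lborel. (\<Sum>x\<in>X. divergence (H x) y))"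
    using op by (intro set_lebesgue_integral_cong) auto
  also have "\<dots> = (\<Sum>x\<in>X. LINT y:\<Omega>|lborel. divergence (H x) y)"
    using set_integrable_divergence[OF op domain(2) H_C1]
    unfolding set_lebesgue_integral_def set_integrable_def
    by (simp add: scaleR_sum_right sum_distrib_left Bochner_Integration.integral_sum)
  also have "\<dots> = 0" using H_0 by simp
  finally show ?thesis .
qed


subsection \<open>The energy estimate\<close>

text \<open>The boundary value in \<open>no_flux\<close> is a limit from inside, hence the value of
  the continuous extension. The point is outside the open set but in its closure, so the filter is
  nontrivial and the limit unique.\<close>

lemma Lim_gradient_frontier:
  assumes "open \<Omega>" "x \<in> frontier \<Omega>" and g: "continuous_on (closure \<Omega>) g" "\<And>y. y \<in> \<Omega> \<Longrightarrow> GDERIV f y :> g y"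
  shows "Lim (at x within \<Omega>) (gradient f) = g x"
proof (rule tendsto_Lim)
  have x: "x \<in> closure \<Omega>" "x \<notin> \<Omega>" using assms(1,2) by (auto simp: frontier_def interior_open)
  then show "\<not> trivial_limit (at x within \<Omega>)"
    by (simp add: trivial_limit_within closure_def)
  have "(g \<longlongrightarrow> g x) (at x within \<Omega>)"
    using g(1) x(1) closure_subset unfolding continuous_on_def by (blast intro: tendsto_within_subset)
  moreover have "\<forall>\<^sub>F y in at x within \<Omega>. g y = gradient f y"
    using gradient_eq[OF g(2)] by (auto simp: eventually_at_filter)
  ultimately show "(gradient f \<longlongrightarrow> g x) (at x within \<Omega>)" by (rule Lim_transform_eventually)
qed

lemma C1_closure_mobility:
  assumes "C1_closure \<Omega> u"
  shows "C1_closure \<Omega> (\<lambda>x. mobility l (u x))"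
  unfolding mobility_def
proof (rule C1_closure_compose[where p = "\<lambda>s. (1 - s\<^sup>2) ^ l" and p' = "\<lambda>s. real l * (1 - s\<^sup>2) ^ (l - 1) * (- (2 * s))", OF assms])
  show "((\<lambda>s. (1 - s\<^sup>2) ^ l) has_real_derivative real l * (1 - (u x)\<^sup>2) ^ (l - 1) * (- (2 * u x))) (at (u x))" for x
    by (auto intro!: derivative_eq_intros)
qed (intro continuous_intros)

lemma mobility_nonneg: "s \<in> {-1..1} \<Longrightarrow> 0 \<le> mobility l s"
  unfolding mobility_def by (intro zero_le_power) (auto simp: abs_square_le_1 abs_le_iff)

text \<open>The discrete chain rule that the quotient is designed for; when \<open>s = t\<close>
  both sides are 0.\<close>

lemma diff_quotient_mult: "diff_quotient Q s t * (s - t) = Q s - Q t"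
  by (simp add: diff_quotient_def)

lemma convex_splitting_le:
  assumes "convex_on UNIV W\<^sub>c" "convex_on UNIV W\<^sub>e" "W\<^sub>c C1_differentiable_on UNIV" "W\<^sub>e C1_differentiable_on UNIV"
  shows "(W\<^sub>c s - W\<^sub>e s) - (W\<^sub>c t - W\<^sub>e t) \<le> (deriv W\<^sub>c s - deriv W\<^sub>e t) * (s - t)"
proof -
  have tangent: "deriv f c * (x - c) \<le> f x - f c" if "convex_on UNIV f" "f C1_differentiable_on UNIV" for f :: "real \<Rightarrow> real" and x c
  proof -
    have "f field_differentiable (at c)"
      using that(2) by (auto simp: C1_differentiable_on_def field_differentiable_def has_real_derivative_iff_has_vector_derivative)
    then have "(f has_real_derivative deriv f c) (at c)"
      by (simp add: DERIV_deriv_iff_field_differentiable)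
    then show ?thesis
      using convex_on_imp_above_tangent[OF that(1), of c x "deriv f c"] by simp
  qed
  from tangent[OF assms(1,3), of s t] tangent[OF assms(2,4), of t s] show ?thesis
    by (simp add: algebra_simps)
qed

theorem theorem7:
  fixes \<Omega> :: "'a::euclidean_space set"
    and \<phi>\<^sub>0 \<phi>\<^sub>1 \<psi> :: "'a \<Rightarrow> real"
    and Q W\<^sub>c W\<^sub>e :: "real \<Rightarrow> real"
    and \<epsilon> \<delta>t :: real and l :: nat
  assumes domain: "lipschitz_domain \<Omega>" "bounded \<Omega>"
    and Q_maps: "Q \<in> {-1..1} \<rightarrow> {-1..1}"
    and Q_smooth: "smooth_on_interval {-1..1} Q"
    and Q_odd: "\<forall>s\<in>{-1..1}. Q (- s) = - Q s"
    and Q_mono: "strict_mono_on {-1..1} Q"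
    and Q_ends: "Q 1 = 1" "Q (-1) = -1"
    and Q_deriv: "\<forall>s\<in>{-1<..<1}. vector_derivative Q (at s within {-1..1}) > 0"
    and eps: "\<epsilon> > 0"
    and W_split: "\<forall>s. double_well s = W\<^sub>c s - W\<^sub>e s"
    and W_C1: "W\<^sub>c C1_differentiable_on UNIV" "W\<^sub>e C1_differentiable_on UNIV"
    and W_convex: "convex_on UNIV W\<^sub>c" "convex_on UNIV W\<^sub>e"
    and step: "\<delta>t > 0"
    and range: "\<phi>\<^sub>0 \<in> closure \<Omega> \<rightarrow> {-1..1}" "\<phi>\<^sub>1 \<in> closure \<Omega> \<rightarrow> {-1..1}"
    and regular: "C1_closure \<Omega> \<phi>\<^sub>0" "C2_closure \<Omega> \<phi>\<^sub>1" "C2_closure \<Omega> \<psi>"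
    and eq1: "\<forall>x\<in>\<Omega>. (Q (\<phi>\<^sub>1 x) - Q (\<phi>\<^sub>0 x)) / \<delta>t =
                divergence (\<lambda>y. mobility l (\<phi>\<^sub>0 y) *\<^sub>R gradient \<psi> y) x"
    and eq2: "\<forall>x\<in>\<Omega>. diff_quotient Q (\<phi>\<^sub>1 x) (\<phi>\<^sub>0 x) * \<psi> x =
                1 / \<epsilon> * (deriv W\<^sub>c (\<phi>\<^sub>1 x) - deriv W\<^sub>e (\<phi>\<^sub>0 x)) - \<epsilon> * laplacian \<phi>\<^sub>1 x"
    and no_flux: "no_flux \<Omega> \<phi>\<^sub>1" "no_flux \<Omega> \<psi>"
  shows "energy \<Omega> \<epsilon> \<phi>\<^sub>1 - energy \<Omega> \<epsilon> \<phi>\<^sub>0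
           \<le> - \<delta>t * (LINT x:\<Omega>|lborel. mobility l (\<phi>\<^sub>0 x) * (norm (gradient \<psi> x))\<^sup>2)
             - \<epsilon> / 2 * (LINT x:\<Omega>|lborel. (norm (gradient (\<lambda>y. \<phi>\<^sub>1 y - \<phi>\<^sub>0 y) x))\<^sup>2)
         \<and> energy \<Omega> \<epsilon> \<phi>\<^sub>1 \<le> energy \<Omega> \<epsilon> \<phi>\<^sub>0"
proof -
  have op: "open \<Omega>" using domain(1) by (simp add: lipschitz_domain_def)
  have \<Omega>_sets: "\<Omega> \<in> sets lborel" using op by simp
  obtain g\<^sub>1 where g1: "C1_closure \<Omega> g\<^sub>1" "\<And>x. x \<in> \<Omega> \<Longrightarrow> GDERIV \<phi>\<^sub>1 x :> g\<^sub>1 x"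
    and c1: "continuous_on (closure \<Omega>) \<phi>\<^sub>1"
    using regular(2) by (auto simp: C2_closure_def)
  obtain g\<psi> where g\<psi>: "C1_closure \<Omega> g\<psi>" "\<And>x. x \<in> \<Omega> \<Longrightarrow> GDERIV \<psi> x :> g\<psi> x"
    and c\<psi>: "continuous_on (closure \<Omega>) \<psi>"
    using regular(3) by (auto simp: C2_closure_def)
  obtain g\<^sub>0 where g0: "continuous_on (closure \<Omega>) g\<^sub>0" "\<And>x. x \<in> \<Omega> \<Longrightarrow> GDERIV \<phi>\<^sub>0 x :> g\<^sub>0 x"
    using C1_closure_gradient[OF regular(1)] by blast
  note cg1 = C1_closure_imp_continuous_on[OF g1(1)]
  note cg\<psi> = C1_closure_imp_continuous_on[OF g\<psi>(1)]
  note c0 = C1_closure_imp_continuous_on[OF regular(1)]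
  have \<phi>1_C1: "C1_closure \<Omega> \<phi>\<^sub>1" by (rule GDERIV_imp_C1_closure[OF c1 cg1 g1(2)])
  have \<psi>_C1: "C1_closure \<Omega> \<psi>" by (rule GDERIV_imp_C1_closure[OF c\<psi> cg\<psi> g\<psi>(2)])
  have grad_w: "GDERIV (\<lambda>y. \<phi>\<^sub>1 y - \<phi>\<^sub>0 y) x :> g\<^sub>1 x - g\<^sub>0 x" if "x \<in> \<Omega>" for x
    using that by (intro GDERIV_diff g1 g0)

  \<comment> \<open>\<open>A\<close> is the mass flux. Testing the first equation with
    \<open>\<psi>\<close> and the Laplacian with the increment leaves \<open>P\<^sub>1\<close> and
    \<open>P\<^sub>2\<close> as the fields under a divergence.\<close>
  define A where "A y = mobility l (\<phi>\<^sub>0 y) *\<^sub>R g\<psi> y" for y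
  define P\<^sub>1 where "P\<^sub>1 y = \<psi> y *\<^sub>R A y" for y
  define P\<^sub>2 where "P\<^sub>2 y = (\<phi>\<^sub>1 y - \<phi>\<^sub>0 y) *\<^sub>R g\<^sub>1 y" for y
  have A_C1: "C1_closure \<Omega> A"
    unfolding A_def[abs_def] by (intro C1_closure_scaleR C1_closure_mobility regular(1) g\<psi>(1))
  have P1_C1: "C1_closure \<Omega> P\<^sub>1"
    unfolding P\<^sub>1_def[abs_def] by (intro C1_closure_scaleR \<psi>_C1 A_C1)
  have P2_C1: "C1_closure \<Omega> P\<^sub>2"
    unfolding P\<^sub>2_def[abs_def] by (intro C1_closure_scaleR C1_closure_diff \<phi>1_C1 regular(1) g1(1))
  have tang1: "n \<bullet> g\<^sub>1 x = 0" if "x \<in> frontier \<Omega>" "outward_unit_normal \<Omega> x n" for x n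
    using no_flux(1) that Lim_gradient_frontier[OF op that(1) cg1 g1(2)] by (auto simp: no_flux_def)
  have tang\<psi>: "n \<bullet> g\<psi> x = 0" if "x \<in> frontier \<Omega>" "outward_unit_normal \<Omega> x n" for x n
    using no_flux(2) that Lim_gradient_frontier[OF op that(1) cg\<psi> g\<psi>(2)] by (auto simp: no_flux_def)
  have P1_0: "(LINT x:\<Omega>|lborel. divergence P\<^sub>1 x) = 0"
    by (rule integral_divergence_eq_0[OF domain P1_C1]) (simp add: P\<^sub>1_def A_def tang\<psi>)
  have P2_0: "(LINT x:\<Omega>|lborel. divergence P\<^sub>2 x) = 0"
    by (rule integral_divergence_eq_0[OF domain P2_C1]) (simp add: P\<^sub>2_def tang1)

  define e where "e \<phi> g x = 1 / \<epsilon> * double_well (\<phi> x) + \<epsilon> / 2 * (norm (g x))\<^sup>2" for \<phi> :: "'a \<Rightarrow> real" and g :: "'a \<Rightarrow> 'a" and x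
  define D where "D x = mobility l (\<phi>\<^sub>0 x) * (norm (g\<psi> x))\<^sup>2" for x
  define N where "N x = (norm (g\<^sub>1 x - g\<^sub>0 x))\<^sup>2" for x
  \<comment> \<open>Everything except the vanishing of the two divergences is settled point by
    point, including the use of convexity.\<close>
  have pointwise: "e \<phi>\<^sub>1 g\<^sub>1 x - e \<phi>\<^sub>0 g\<^sub>0 x + \<epsilon> / 2 * N x \<le> \<delta>t * divergence P\<^sub>1 x + \<epsilon> * divergence P\<^sub>2 x - \<delta>t * D x"
    if x: "x \<in> \<Omega>" for x
  proof -
    let ?a = "\<phi>\<^sub>1 x" and ?b = "\<phi>\<^sub>0 x"
    have lap: "laplacian \<phi>\<^sub>1 x = divergence g\<^sub>1 x"
      unfolding laplacian_def
      by (rule divergence_cong[OF op x _ C1_closure_differentiable[OF g1(1) x]]) (simp add: gradient_eq[OF g1(2)])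
    have "divergence (\<lambda>y. mobility l (\<phi>\<^sub>0 y) *\<^sub>R gradient \<psi> y) x = divergence A x"
      by (rule divergence_cong[OF op x _ C1_closure_differentiable[OF A_C1 x]]) (simp add: A_def gradient_eq[OF g\<psi>(2)])
    then have divA: "\<delta>t * divergence A x = Q ?a - Q ?b"
      using eq1 x step by (simp add: field_simps)
    obtain A' G' where A': "(A has_derivative A') (at x)" and G': "(g\<^sub>1 has_derivative G') (at x)"
      using C1_closure_differentiable[OF A_C1 x] C1_closure_differentiable[OF g1(1) x] by (auto simp: differentiable_def)
    \<comment> \<open>The product rule releases the gradient of \<open>\<psi>\<close> paired with
      the flux, which is the dissipation density \<open>D\<close>.\<close>
    have divP1: "divergence P\<^sub>1 x = \<psi> x * divergence A x + D x"
      unfolding P\<^sub>1_def[abs_def] divergence_scaleR[OF g\<psi>(2)[OF x] A']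
      by (simp add: A_def D_def power2_norm_eq_inner)
    have divP2: "divergence P\<^sub>2 x = (?a - ?b) * divergence g\<^sub>1 x + (g\<^sub>1 x - g\<^sub>0 x) \<bullet> g\<^sub>1 x"
      unfolding P\<^sub>2_def[abs_def] by (rule divergence_scaleR[OF grad_w[OF x] G'])
    have "(Q ?a - Q ?b) * \<psi> x = (diff_quotient Q ?a ?b * \<psi> x) * (?a - ?b)"
      by (simp add: diff_quotient_mult[symmetric])
    also have "\<dots> = 1 / \<epsilon> * ((deriv W\<^sub>c ?a - deriv W\<^sub>e ?b) * (?a - ?b)) - \<epsilon> * (divergence g\<^sub>1 x * (?a - ?b))"
      using eq2 x lap by (simp add: left_diff_distrib)
    finally have scheme: "(Q ?a - Q ?b) * \<psi> x =
        1 / \<epsilon> * ((deriv W\<^sub>c ?a - deriv W\<^sub>e ?b) * (?a - ?b)) - \<epsilon> * (divergence g\<^sub>1 x * (?a - ?b))" .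
    have "double_well ?a - double_well ?b \<le> (deriv W\<^sub>c ?a - deriv W\<^sub>e ?b) * (?a - ?b)"
      using convex_splitting_le[OF W_convex W_C1, of ?a ?b] W_split by simp
    then have "1 / \<epsilon> * (double_well ?a - double_well ?b) \<le> 1 / \<epsilon> * ((deriv W\<^sub>c ?a - deriv W\<^sub>e ?b) * (?a - ?b))"
      using eps by (intro mult_left_mono) auto
    then have well: "1 / \<epsilon> * double_well ?a - 1 / \<epsilon> * double_well ?b \<le> (Q ?a - Q ?b) * \<psi> x + \<epsilon> * (divergence g\<^sub>1 x * (?a - ?b))"
      using scheme by (simp only: right_diff_distrib)
    \<comment> \<open>Polarisation, with the gradient term evaluated at the new time; this is where
      the square of the gradient increment enters.\<close>
    have grad: "\<epsilon> / 2 * (norm (g\<^sub>1 x))\<^sup>2 - \<epsilon> / 2 * (norm (g\<^sub>0 x))\<^sup>2 + \<epsilon> / 2 * N x = \<epsilon> * ((g\<^sub>1 x - g\<^sub>0 x) \<bullet> g\<^sub>1 x)"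
      unfolding N_def power2_norm_eq_inner
      by (simp add: inner_diff_left inner_diff_right inner_commute[of "g\<^sub>0 x" "g\<^sub>1 x"] field_simps)
    have "\<delta>t * divergence P\<^sub>1 x = (Q ?a - Q ?b) * \<psi> x + \<delta>t * D x"
      unfolding divP1 divA[symmetric] by (simp add: algebra_simps)
    then show ?thesis
      using well grad unfolding e_def divP2 by (simp add: algebra_simps)
  qed

  have c_dw: "continuous_on (closure \<Omega>) (\<lambda>x. double_well (u x))" if "continuous_on (closure \<Omega>) u" for u
    unfolding double_well_def by (intro continuous_intros that)
  have int_e: "set_integrable lborel \<Omega> (e \<phi>\<^sub>1 g\<^sub>1)" "set_integrable lborel \<Omega> (e \<phi>\<^sub>0 g\<^sub>0)"
    unfolding e_def[abs_def]
    by (intro set_integrable_continuous_on_closure[OF op domain(2)] continuous_intros c_dw c0 c1 cg1 g0(1))+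
  have int_N: "set_integrable lborel \<Omega> N"
    unfolding N_def[abs_def]
    by (intro set_integrable_continuous_on_closure[OF op domain(2)] continuous_intros cg1 g0(1))
  have int_D: "set_integrable lborel \<Omega> D"
    unfolding D_def[abs_def]
    by (intro set_integrable_continuous_on_closure[OF op domain(2)] continuous_intros cg\<psi>
        C1_closure_imp_continuous_on[OF C1_closure_mobility[OF regular(1)]])
  have int_P: "set_integrable lborel \<Omega> (divergence P\<^sub>1)" "set_integrable lborel \<Omega> (divergence P\<^sub>2)"
    by (intro set_integrable_divergence op domain(2) P1_C1 P2_C1)+
  have energy: "energy \<Omega> \<epsilon> \<phi>\<^sub>1 = (LINT x:\<Omega>|lborel. e \<phi>\<^sub>1 g\<^sub>1 x)" "energy \<Omega> \<epsilon> \<phi>\<^sub>0 = (LINT x:\<Omega>|lborel. e \<phi>\<^sub>0 g\<^sub>0 x)"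
    unfolding energy_def e_def
    by (intro set_lebesgue_integral_cong \<Omega>_sets; simp add: gradient_eq[OF g1(2)] gradient_eq[OF g0(2)])+
  have D_eq: "(LINT x:\<Omega>|lborel. mobility l (\<phi>\<^sub>0 x) * (norm (gradient \<psi> x))\<^sup>2) = (LINT x:\<Omega>|lborel. D x)"
    by (intro set_lebesgue_integral_cong \<Omega>_sets) (simp add: D_def gradient_eq[OF g\<psi>(2)])
  have N_eq: "(LINT x:\<Omega>|lborel. (norm (gradient (\<lambda>y. \<phi>\<^sub>1 y - \<phi>\<^sub>0 y) x))\<^sup>2) = (LINT x:\<Omega>|lborel. N x)"
    by (intro set_lebesgue_integral_cong \<Omega>_sets) (simp add: N_def gradient_eq[OF grad_w])
  have "(LINT x:\<Omega>|lborel. e \<phi>\<^sub>1 g\<^sub>1 x - e \<phi>\<^sub>0 g\<^sub>0 x + \<epsilon> / 2 * N x)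
      \<le> (LINT x:\<Omega>|lborel. \<delta>t * divergence P\<^sub>1 x + \<epsilon> * divergence P\<^sub>2 x - \<delta>t * D x)"
    by (rule set_integral_mono) (use pointwise int_e int_N int_D int_P in auto)
  then have main: "energy \<Omega> \<epsilon> \<phi>\<^sub>1 - energy \<Omega> \<epsilon> \<phi>\<^sub>0 + \<epsilon> / 2 * (LINT x:\<Omega>|lborel. N x) \<le> - \<delta>t * (LINT x:\<Omega>|lborel. D x)"
    using int_e int_N int_D int_P P1_0 P2_0 by (simp add: energy)
  \<comment> \<open>For the decay of the energy: the mobility is nonnegative since
    \<open>\<phi>\<^sub>0\<close> takes values between -1 and 1; beyond them an odd power would be
    negative.\<close>
  have "0 \<le> (LINT x:\<Omega>|lborel. D x)"
    unfolding set_lebesgue_integral_def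
  proof (intro integral_nonneg_AE AE_I2)
    fix x
    show "0 \<le> indicator \<Omega> x *\<^sub>R D x"
    proof (cases "x \<in> \<Omega>")
      case True
      then have "\<phi>\<^sub>0 x \<in> {-1..1}" using range(1) closure_subset by blast
      then show ?thesis by (simp add: D_def mobility_nonneg)
    qed simp
  qed
  moreover have "0 \<le> (LINT x:\<Omega>|lborel. N x)"
    unfolding set_lebesgue_integral_def
    by (intro integral_nonneg_AE AE_I2) (simp add: N_def)
  ultimately have "0 \<le> \<delta>t * (LINT x:\<Omega>|lborel. D x)" "0 \<le> \<epsilon> / 2 * (LINT x:\<Omega>|lborel. N x)"
    using step eps by auto
  with main show ?thesis
    unfolding D_eq N_eq by simp
qed

end
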